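(* Let $\Omega$ be a bounded open convex domain in $\mathbb{R}^n$. Suppose that $u,v\in C(\overline\Omega)\cap C^5(\Omega)$ are strictly convex functions in $\Omega$ with $u=v=0$ on $\partial\Omega$ and that there is a constant $M>0$ such that $$\int_\Omega(\det D^2u)^{\frac1n}(\det D^2v)^{\frac{n-1}n}\,dx\le M\quad\text{and}\quad\int_\Omega\det D^2v\,dx\le M.$$ Then $$\int_\Omega|u|\det D^2v\,dx\ge\int_\Omega|v|(\det D^2u)^{\frac1n}(\det D^2v)^{\frac{n-1}n}\,dx.$$
   Context: The dimension $n\ge2$ is fixed. All bounded open convex domains are assumed to have nonempty interior. A convex function $u$ on an open bounded convex domain $\Omega$ is strictly convex in $\Omega$ if for any $x\in\Omega$ and $p\in\partial u(x)$ one has $u(z)>u(x)+p\cdot(z-x)$ for all $z\in\Omega\setminus\{x\}$, where $\partial u(x)=\{p\in\mathbb{R}^n:u(y)\ge u(x)+p\cdot(y-x)\ \forall y\in\Omega\}$. *)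

theory Defs
  imports "HOL-Analysis.Analysis"
begin

(* C^k regularity, meant for open S: continuity of all iterated directional derivatives up
   to order k, each derivative being the Frechet derivative of the previous one. *)
primrec C_on :: "nat \<Rightarrow> 'a::real_normed_vector set \<Rightarrow> ('a \<Rightarrow> 'b::real_normed_vector) \<Rightarrow> bool"
where
  "C_on 0 S f \<longleftrightarrow> continuous_on S f"
| "C_on (Suc k) S f \<longleftrightarrow> (\<forall>x\<in>S. f differentiable (at x)) \<and>
     (\<forall>d. C_on k S (\<lambda>x. frechet_derivative f (at x) d))"

definition partial_deriv :: "'n \<Rightarrow> (real ^ 'n::finite \<Rightarrow> real) \<Rightarrow> real ^ 'n \<Rightarrow> real" where
  "partial_deriv i f x = frechet_derivative f (at x) (axis i 1)"

definition hessian :: "(real ^ 'n::finite \<Rightarrow> real) \<Rightarrow> real ^ 'n \<Rightarrow> real ^ 'n ^ 'n" where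
  "hessian f x = (\<chi> i j. partial_deriv i (partial_deriv j f) x)"

definition subdifferential ::
  "'a::real_inner set \<Rightarrow> ('a \<Rightarrow> real) \<Rightarrow> 'a \<Rightarrow> 'a set" where
  "subdifferential \<Omega> u x = {p. \<forall>y\<in>\<Omega>. u y \<ge> u x + p \<bullet> (y - x)}"

definition strictly_convex_on :: "'a::real_inner set \<Rightarrow> ('a \<Rightarrow> real) \<Rightarrow> bool" where
  "strictly_convex_on \<Omega> u \<longleftrightarrow> convex_on \<Omega> u \<and>
     (\<forall>x\<in>\<Omega>. \<forall>p\<in>subdifferential \<Omega> u x. \<forall>z\<in>\<Omega> - {x}. u z > u x + p \<bullet> (z - x))"

end

theory Submission
  imports Defs
begin

text \<open>
  Write \<open>H v\<close> for the Hessian of \<open>v\<close> and \<open>C\<close> for its cofactor matrix. The operator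
  \<open>L f = \<Sum> C i j * \<partial>i \<partial>j f\<close> (the linearised Monge-Ampere operator) satisfies three facts.

  \<^item> \<open>L v = n * det (H v)\<close>, by Euler's identity for the determinant (\<open>det_deriv_self\<close>).
  \<^item> \<open>L u \<ge> n * det (H u) powr (1/n) * det (H v) powr ((n-1)/n)\<close> for convex \<open>u\<close> and \<open>v\<close>, a form
    of the arithmetic-geometric mean inequality for matrices (\<open>det_deriv_ge\<close>).
  \<^item> \<open>L\<close> is symmetric, because the columns of \<open>C\<close> are divergence free
    (\<open>cofactor_divergence_free\<close>): the integrals of \<open>p * L u\<close> and \<open>u * L p\<close> agree
    whenever \<open>p\<close> vanishes outside a compact subset of \<open>\<Omega>\<close>
    (\<open>integral_divergence_form_symmetric\<close>).

  With \<open>p = - v\<close> the three facts would give the theorem at once, since \<open>u\<close> and \<open>v\<close> are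
  nonpositive; but \<open>v\<close> does not have compact support and its gradient may blow up at the boundary.
  So \<open>p = G (- v)\<close> is used, where \<open>G\<close> is convex of class \<open>C\<^sup>2\<close>, has slope at most \<open>1\<close> and vanishes
  near \<open>0\<close>. As \<open>v\<close> is continuous up to the boundary and zero there, \<open>p\<close> has compact support in
  \<open>\<Omega>\<close>. Convexity of \<open>G\<close> makes the error have the right sign:
  \<open>L p = G'' (- v) * (\<Sum> C i j * \<partial>i v * \<partial>j v) - G' (- v) * L v \<ge> - n * det (H v)\<close>.
  As \<open>u \<le> 0\<close>, this bounds the integral of \<open>u * L p\<close> by \<open>n\<close> times that of
  \<open>\<bar>u\<bar> * det (H v)\<close> (\<open>cutoff_integral_inequality\<close>). Finally \<open>G\<close> runs through functions
  that converge to the identity on \<open>t \<ge> 0\<close>, and Fatou's lemma gives the theorem.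
\<close>


section \<open>The derivative of the determinant\<close>

definition replace_row :: "'n \<Rightarrow> 'a ^ 'n \<Rightarrow> 'a ^ 'n ^ 'n \<Rightarrow> 'a ^ 'n ^ 'n" where
  "replace_row i x A = (\<chi> k. if k = i then x else A $ k)"

text \<open>The derivative of \<open>det\<close> at \<open>A\<close> in the direction \<open>B\<close>, which is also the contraction of \<open>B\<close>
  with the cofactor matrix of \<open>A\<close>. The cofactors appear as determinants with one replaced row, so
  that multilinearity and antisymmetry of \<open>det\<close> apply to them directly.\<close>
definition det_deriv :: "real ^ 'n ^ 'n \<Rightarrow> real ^ 'n ^ 'n \<Rightarrow> real" where
  "det_deriv A B = (\<Sum>i\<in>UNIV. det (replace_row i (B $ i) A))"

lemma replace_row_self: "replace_row i (A $ i) A = A"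
  by (simp add: replace_row_def vec_eq_iff)

lemma det_replace_row_add:
  "det (replace_row i (x + y) A) = det (replace_row i x A) + det (replace_row i (y::'a::comm_ring_1^'n) A)"
  unfolding replace_row_def by (rule det_row_add)

lemma det_replace_row_scale:
  "det (replace_row i (c *s x) A) = c * det (replace_row i (x::'a::comm_ring_1^'n) A)"
  unfolding replace_row_def by (rule det_row_mul)

lemma det_replace_row_expand:
  fixes x :: "real ^ 'n"
  shows "det (replace_row i x A) = (\<Sum>j\<in>UNIV. x $ j * det (replace_row i (axis j 1) A))"
proof -
  have "det (replace_row i (\<Sum>j\<in>UNIV. x $ j *s axis j 1) A)
      = (\<Sum>j\<in>UNIV. det (replace_row i (x $ j *s axis j 1) A))"
    unfolding replace_row_def by (rule det_linear_row_sum) simp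
  then show ?thesis
    by (simp add: basis_expansion det_replace_row_scale)
qed

lemma det_deriv_expand:
  "det_deriv A B = (\<Sum>i\<in>UNIV. \<Sum>j\<in>UNIV. B $ i $ j * det (replace_row i (axis j 1) A))"
  unfolding det_deriv_def by (subst det_replace_row_expand) simp

lemma det_deriv_add: "det_deriv A (B + C) = det_deriv A B + det_deriv A C"
  by (simp add: det_deriv_def det_replace_row_add sum.distrib)

lemma det_deriv_scale: "det_deriv A (c *\<^sub>R B) = c * det_deriv A B"
  by (simp add: det_deriv_def det_replace_row_scale sum_distrib_left flip: scalar_mult_eq_scaleR)

text \<open>Row \<open>i\<close> of \<open>B ** A\<close> is a combination of the rows of \<open>A\<close>, in which row \<open>i\<close> has the
  coefficient \<open>B $ i $ i\<close>; this is Cramer's rule.\<close>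
lemma det_deriv_mult: "det_deriv A (B ** A) = trace B * det A"
proof -
  have "det (replace_row i ((B ** A) $ i) A) = B $ i $ i * det A" for i
  proof -
    have "replace_row i ((B ** A) $ i) A
        = (\<chi> k. if k = i then (\<Sum>l\<in>UNIV. B $ i $ l *s row l A) else row k A)"
      by (auto simp: replace_row_def vec_eq_iff matrix_matrix_mult_def row_def)
    then show ?thesis using cramer_lemma_transpose[of i "B $ i" A] by simp
  qed
  then show ?thesis by (simp add: det_deriv_def trace_def sum_distrib_right)
qed

lemma det_deriv_self: "det_deriv A A = real CARD('n) * det (A :: real ^ 'n ^ 'n)"
  using det_deriv_mult[of A "mat 1"] by (simp add: trace_I)

lemma det_replace_two_rows_swap:
  fixes A :: "real ^ 'n ^ 'n"
  assumes "i \<noteq> k"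
  shows "det (replace_row k x (replace_row i y A)) = - det (replace_row i x (replace_row k y A))"
proof -
  let ?p = "Transposition.transpose i k"
  have "(\<chi> m. replace_row i x (replace_row k y A) $ ?p m) = replace_row k x (replace_row i y A)"
    using assms by (auto simp: replace_row_def vec_eq_iff Transposition.transpose_def)
  moreover have "?p permutes UNIV" by (simp add: permutes_swap_id)
  ultimately show ?thesis
    using det_permute_rows[of ?p "replace_row i x (replace_row k y A)"] assms
    by (simp add: sign_swap_id)
qed

text \<open>The algebraic reason why cofactor matrices of Hessians are divergence free: exchanging \<open>i\<close> and
  \<open>k\<close> exchanges two rows of the determinant and leaves \<open>T\<close> unchanged, so the terms cancel
  in pairs.\<close>
lemma sum_det_replace_two_rows_symmetric:
  fixes T :: "'n \<Rightarrow> 'n \<Rightarrow> real ^ 'n"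
  assumes "\<And>i k. T i k = T k i"
  shows "(\<Sum>i\<in>UNIV. \<Sum>k\<in>UNIV - {i}. det (replace_row k (T i k) (replace_row i e A))) = 0"
proof -
  define f where "f i k = (if k = i then 0 else det (replace_row k (T i k) (replace_row i e A)))" for i k
  have anti: "f i k = - f k i" for i k
  proof (cases "k = i")
    case False
    have "det (replace_row k (T i k) (replace_row i e A))
        = - det (replace_row i (T i k) (replace_row k e A))"
      using False by (intro det_replace_two_rows_swap) auto
    also have "replace_row i (T i k) (replace_row k e A) = replace_row i (T k i) (replace_row k e A)"
      using assms[of i k] by simp
    finally show ?thesis using False by (simp add: f_def)
  qed (simp add: f_def)
  have "(\<Sum>i\<in>UNIV. \<Sum>k\<in>UNIV. f i k) = (\<Sum>k\<in>UNIV. \<Sum>i\<in>UNIV. f i k)"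
    by (rule sum.swap)
  also have "\<dots> = - (\<Sum>k\<in>UNIV. \<Sum>i\<in>UNIV. f k i)"
    by (subst anti) (simp add: sum_negf)
  finally have "(\<Sum>i\<in>UNIV. \<Sum>k\<in>UNIV. f i k) = 0" by simp
  moreover have "(\<Sum>k\<in>UNIV. f i k) = (\<Sum>k\<in>UNIV - {i}. det (replace_row k (T i k) (replace_row i e A)))" for i
    by (subst sum.remove[of UNIV i]) (auto simp: f_def intro!: sum.cong)
  ultimately show ?thesis by simp
qed

text \<open>The permutations that contribute on the left map \<open>i\<close> to \<open>j\<close>; their inverses are the ones that
  contribute on the right.\<close>
lemma det_replace_row_axis_transpose:
  fixes A :: "real ^ 'n ^ 'n"
  shows "det (replace_row i (axis j 1) A) = det (replace_row j (axis i 1) (transpose A))"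
proof -
  let ?P = "{p. p permutes (UNIV :: 'n set)}"
  have expand: "(\<Prod>k\<in>UNIV. replace_row i (axis j 1) A $ k $ p k)
      = (if p i = j then (\<Prod>k\<in>UNIV - {i}. A $ k $ p k) else 0)" for i j p and A :: "real^'n^'n"
  proof -
    have "(\<Prod>k\<in>UNIV. replace_row i (axis j 1) A $ k $ p k)
        = axis j 1 $ p i * (\<Prod>k\<in>UNIV - {i}. A $ k $ p k)"
      by (subst prod.remove[of UNIV i]) (auto simp: replace_row_def intro!: prod.cong)
    then show ?thesis by (auto simp: axis_def)
  qed
  have "det (replace_row j (axis i 1) (transpose A))
      = (\<Sum>p\<in>?P. of_int (sign (inv p)) *
          (\<Prod>k\<in>UNIV. replace_row j (axis i 1) (transpose A) $ k $ inv p k))"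
    unfolding det_def by (rule sum_permutations_inverse)
  also have "\<dots> = (\<Sum>p\<in>?P. of_int (sign p) * (\<Prod>k\<in>UNIV. replace_row i (axis j 1) A $ k $ p k))"
  proof (rule sum.cong[OF refl], unfold expand, goal_cases)
    case (1 p)
    then have p: "p permutes UNIV" by simp
    have inv: "inv p (p k) = k" "p (inv p k) = k" for k
      using permutes_inverses[OF p] by auto
    have "(\<Prod>m\<in>UNIV - {j}. transpose A $ m $ inv p m) = (\<Prod>k\<in>UNIV - {i}. A $ k $ p k)" if "p i = j"
      by (rule prod.reindex_bij_witness[of _ p "inv p"])
         (use that inv in \<open>auto simp: transpose_def, metis\<close>)
    moreover have "inv p j = i \<longleftrightarrow> p i = j" using inv by metis
    moreover have "sign (inv p) = sign p"
      using sign_inverse[of p] p by (metis finite_class.finite_UNIV permutation_permutes)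
    ultimately show ?case by auto
  qed
  finally show ?thesis unfolding det_def by simp
qed

lemma det_has_real_derivative:
  fixes M :: "real \<Rightarrow> real ^ 'n ^ 'n"
  assumes "\<And>k l. ((\<lambda>t. M t $ k $ l) has_real_derivative B $ k $ l) (at t)"
  shows "((\<lambda>t. det (M t)) has_real_derivative det_deriv (M t) B) (at t)"
proof -
  let ?P = "{p. p permutes (UNIV :: 'n set)}"
  have "((\<lambda>t. det (M t)) has_real_derivative
      (\<Sum>p\<in>?P. of_int (sign p) * (\<Sum>i\<in>UNIV. B $ i $ p i * (\<Prod>k\<in>UNIV - {i}. M t $ k $ p k)))) (at t)"
    unfolding det_def
    by (intro DERIV_sum DERIV_cmult has_field_derivative_prod assms)
  also have "(\<Sum>p\<in>?P. of_int (sign p) * (\<Sum>i\<in>UNIV. B $ i $ p i * (\<Prod>k\<in>UNIV - {i}. M t $ k $ p k)))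
      = (\<Sum>i\<in>UNIV. \<Sum>p\<in>?P. of_int (sign p) * (B $ i $ p i * (\<Prod>k\<in>UNIV - {i}. M t $ k $ p k)))"
    by (subst sum.swap) (simp add: sum_distrib_left)
  also have "\<dots> = det_deriv (M t) B"
    unfolding det_deriv_def det_def
  proof (intro sum.cong refl arg_cong2[where f = "(*)"])
    fix i p
    show "B $ i $ p i * (\<Prod>k\<in>UNIV - {i}. M t $ k $ p k) = (\<Prod>k\<in>UNIV. replace_row i (B $ i) (M t) $ k $ p k)"
      by (subst prod.remove[of UNIV i]) (auto simp: replace_row_def intro!: prod.cong)
  qed
  finally show ?thesis .
qed

section \<open>An arithmetic-geometric mean inequality for matrices\<close>

definition pos_semidef :: "real ^ 'n ^ 'n \<Rightarrow> bool" where
  "pos_semidef A \<longleftrightarrow> transpose A = A \<and> (\<forall>x. 0 \<le> x \<bullet> (A *v x))"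

definition pos_def :: "real ^ 'n ^ 'n \<Rightarrow> bool" where
  "pos_def A \<longleftrightarrow> transpose A = A \<and> (\<forall>x. x \<noteq> 0 \<longrightarrow> 0 < x \<bullet> (A *v x))"

lemma symmetric_inner_matrix:
  assumes "transpose A = (A :: real ^ 'n ^ 'n)"
  shows "x \<bullet> (A *v y) = y \<bullet> (A *v x)"
  by (metis assms dot_lmul_matrix inner_commute transpose_matrix_vector)

lemma continuous_on_det [continuous_intros]:
  fixes A :: "'a::topological_space \<Rightarrow> real ^ 'n ^ 'n"
  assumes "continuous_on S A"
  shows "continuous_on S (\<lambda>x. det (A x))"
  unfolding det_def by (intro continuous_intros assms)

lemma congruence_nth:
  fixes P H :: "real ^ 'n ^ 'n"
  shows "(P ** H ** transpose P) $ i $ j = P $ i \<bullet> (H *v P $ j)"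
proof -
  have "(P ** H ** transpose P) $ i $ j = (\<Sum>k\<in>UNIV. \<Sum>l\<in>UNIV. P $ i $ l * H $ l $ k * P $ j $ k)"
    by (simp add: matrix_matrix_mult_def transpose_def sum_distrib_right)
  also have "\<dots> = (\<Sum>l\<in>UNIV. \<Sum>k\<in>UNIV. P $ i $ l * H $ l $ k * P $ j $ k)"
    by (rule sum.swap)
  finally show ?thesis
    by (simp add: inner_vec_def matrix_vector_mult_def sum_distrib_left mult.assoc)
qed

text \<open>The quadratic form attains its minimum on the unit sphere.\<close>
lemma pos_def_coercive:
  assumes "pos_def (H :: real ^ 'n ^ 'n)"
  obtains c where "c > 0" "\<And>x. c * (norm x)\<^sup>2 \<le> x \<bullet> (H *v x)"
proof -
  let ?q = "\<lambda>x. x \<bullet> (H *v x)"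
  have "\<exists>x\<in>sphere 0 1. \<forall>y\<in>sphere 0 1. ?q x \<le> ?q y"
  proof (rule continuous_attains_inf)
    show "sphere 0 1 \<noteq> ({} :: (real ^ 'n) set)"
      using vector_choose_size[of 1] by (force simp: dist_norm)
  qed (auto intro!: continuous_intros)
  then obtain a where a: "norm a = 1" and min: "\<And>y. norm y = 1 \<Longrightarrow> ?q a \<le> ?q y" by auto
  show thesis
  proof
    show "?q a > 0" using assms a unfolding pos_def_def by (metis norm_zero zero_neq_one)
    show "?q a * (norm x)\<^sup>2 \<le> ?q x" for x
    proof (cases "x = 0")
      case False
      have "?q a \<le> ?q (x /\<^sub>R norm x)" using False by (intro min) simp
      also have "\<dots> = ?q x / (norm x)\<^sup>2"
        by (simp add: matrix_vector_mult_scaleR power2_eq_square divide_simps)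
      finally show ?thesis using False by (simp add: field_simps)
    qed simp
  qed
qed

text \<open>Among the matrices whose rows lie in the ellipsoid \<open>x \<bullet> (H *v x) \<le> 1\<close>, take one with largest
  \<open>\<bar>det\<bar>\<close>. Its rows are orthonormal for the inner product given by \<open>H\<close>: replacing a row by a
  shorter vector without changing the determinant would leave room to scale that row up. The
  maximality also yields Hadamard's inequality.\<close>
lemma pos_def_congruent_identity:
  fixes H :: "real ^ 'n ^ 'n"
  assumes H: "pos_def H"
  obtains P where "P ** H ** transpose P = mat 1" "det P \<noteq> 0"
    "\<And>Q. (\<And>i. Q $ i \<bullet> (H *v Q $ i) \<le> 1) \<Longrightarrow> \<bar>det Q\<bar> \<le> \<bar>det P\<bar>"
proof -
  let ?q = "\<lambda>x. x \<bullet> (H *v x)"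
  let ?S = "{Q :: real ^ 'n ^ 'n. \<forall>i. ?q (Q $ i) \<le> 1}"
  obtain c where c: "c > 0" "\<And>x. c * (norm x)\<^sup>2 \<le> ?q x" using pos_def_coercive[OF H] by blast
  have sym: "transpose H = H" and pos: "\<And>x. x \<noteq> 0 \<Longrightarrow> ?q x > 0"
    using H unfolding pos_def_def by auto
  have "compact ?S"
    unfolding compact_eq_bounded_closed
  proof
    have "norm Q \<le> (\<Sum>i\<in>(UNIV::'n set). sqrt (1 / c))" if "Q \<in> ?S" for Q
    proof -
      have "norm (Q $ i) \<le> sqrt (1 / c)" for i
      proof (rule real_le_rsqrt)
        have "?q (Q $ i) \<le> 1" using that by simp
        then have "c * (norm (Q $ i))\<^sup>2 \<le> 1" using c(2)[of "Q $ i"] by linarith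
        then show "(norm (Q $ i))\<^sup>2 \<le> 1 / c" using c(1) by (simp add: field_simps)
      qed
      then show ?thesis
        unfolding norm_vec_def[of Q] by (intro order.trans[OF L2_set_le_sum] sum_mono) auto
    qed
    then show "bounded ?S" unfolding bounded_iff by blast
    have "continuous_on UNIV (\<lambda>Q :: real ^ 'n ^ 'n. H *v Q $ i)" for i
      by (intro linear_continuous_on_compose[OF _ matrix_vector_mul_linear] continuous_intros)
    then show "closed ?S"
      by (intro closed_Collect_all closed_Collect_le continuous_intros)
  qed
  moreover have "?S \<noteq> {}" by (auto intro!: exI[of _ 0])
  moreover have "continuous_on ?S (\<lambda>Q. \<bar>det Q\<bar>)" by (intro continuous_intros)
  ultimately have "\<exists>P\<in>?S. \<forall>Q\<in>?S. \<bar>det Q\<bar> \<le> \<bar>det P\<bar>" by (rule continuous_attains_sup)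
  then obtain P where P: "P \<in> ?S" and max: "\<And>Q. Q \<in> ?S \<Longrightarrow> \<bar>det Q\<bar> \<le> \<bar>det P\<bar>" by blast
  have nz: "det P \<noteq> 0"
  proof -
    define b where "b = Max (range (\<lambda>i. ?q (axis i 1 :: real ^ 'n)))"
    have b: "?q (axis i 1) \<le> b" for i unfolding b_def by (intro Max_ge) auto
    have "b > 0" using pos[of "axis undefined 1"] b[of undefined] by (force simp: axis_eq_0_iff)
    define Q :: "real ^ 'n ^ 'n" where "Q = (\<chi> i. (1 / sqrt b) *s axis i 1)"
    have "det Q = (\<Prod>i\<in>(UNIV::'n set). 1 / sqrt b) * det (mat 1 :: real ^ 'n ^ 'n)"
      unfolding Q_def det_rows_mul
      by (rule arg_cong[where f = "\<lambda>A. (\<Prod>i\<in>(UNIV::'n set). 1 / sqrt b) * det A"])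
         (auto simp: vec_eq_iff mat_def axis_def)
    then have "det Q \<noteq> 0" using \<open>b > 0\<close> by simp
    moreover have "Q \<in> ?S"
    proof clarify
      fix i
      have "?q (Q $ i) = ?q (axis i 1) / b"
        using \<open>b > 0\<close> by (simp add: Q_def scalar_mult_eq_scaleR matrix_vector_mult_scaleR divide_simps)
      then show "?q (Q $ i) \<le> 1" using b[of i] \<open>b > 0\<close> by simp
    qed
    ultimately show ?thesis using max[of Q] by auto
  qed
  \<comment> \<open>otherwise, scaling \<open>x\<close> to the boundary of the ellipsoid would increase the determinant\<close>
  have ge1: "?q x \<ge> 1" if x: "det (replace_row i x P) = det P" for i x
  proof -
    have "x \<noteq> 0"
      using x nz det_replace_row_scale[of i 0 x P] by auto
    then have qx: "?q x > 0" by (rule pos)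
    let ?Q = "replace_row i ((1 / sqrt (?q x)) *s x) P"
    have "?Q \<in> ?S"
      using P qx by (auto simp: replace_row_def scalar_mult_eq_scaleR matrix_vector_mult_scaleR)
    then have "\<bar>det P\<bar> / sqrt (?q x) \<le> \<bar>det P\<bar>"
      using max[of ?Q] qx x by (simp add: det_replace_row_scale abs_mult)
    then have "sqrt (?q x) \<ge> 1" using nz qx by (simp add: field_simps)
    then show ?thesis by simp
  qed
  have diag: "?q (P $ i) = 1" for i
    using ge1[of i "P $ i"] P by (auto simp: replace_row_self intro: antisym)
  have off: "P $ i \<bullet> (H *v P $ j) = 0" if ij: "i \<noteq> j" for i j
  proof -
    \<comment> \<open>subtracting the projection on row \<open>j\<close> keeps the determinant and shortens row \<open>i\<close>\<close>
    define b where "b = P $ i \<bullet> (H *v P $ j)"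
    have "row k P = P $ k" for k by (simp add: row_def)
    then have "det (replace_row i (P $ i + (- b) *s P $ j) P) = det P"
      using det_row_operation[OF ij, of P "- b"] by (simp only: replace_row_def)
    then have "?q (P $ i + (- b) *s P $ j) \<ge> 1" by (rule ge1)
    moreover have "?q (P $ i + (- b) *s P $ j) = ?q (P $ i) - 2 * b * b + b * b * ?q (P $ j)"
      using symmetric_inner_matrix[OF sym, of "P $ j" "P $ i"]
      by (simp add: scalar_mult_eq_scaleR matrix_vector_mult_scaleR matrix_vector_right_distrib
          matrix_vector_mult_diff_distrib inner_add_left inner_add_right inner_diff_left
          inner_diff_right b_def algebra_simps)
    ultimately have "b * b \<le> 0" by (simp add: diag)
    then show ?thesis unfolding b_def[symmetric] by (metis mult_eq_0_iff antisym zero_le_square)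
  qed
  have "P ** H ** transpose P = mat 1"
    unfolding vec_eq_iff congruence_nth by (auto simp: mat_def diag off)
  then show thesis using nz max by (intro that[of P]) auto
qed

lemma pos_def_mat_1: "pos_def (mat 1 :: real ^ 'n ^ 'n)"
  by (simp add: pos_def_def transpose_mat)

text \<open>For \<open>H = mat 1\<close> the maximiser of the previous lemma is an orthogonal matrix, so its determinant
  is \<open>1\<close> or \<open>- 1\<close>.\<close>
lemma abs_det_le_one:
  fixes R :: "real ^ 'n ^ 'n"
  assumes "\<And>i. norm (R $ i) \<le> 1"
  shows "\<bar>det R\<bar> \<le> 1"
proof -
  obtain P :: "real ^ 'n ^ 'n" where P: "P ** mat 1 ** transpose P = mat 1"
    and max: "\<And>Q :: real ^ 'n ^ 'n. (\<And>i. Q $ i \<bullet> (mat 1 *v Q $ i) \<le> 1) \<Longrightarrow> \<bar>det Q\<bar> \<le> \<bar>det P\<bar>"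
    using pos_def_congruent_identity[OF pos_def_mat_1, where 'n = 'n] by metis
  have "(det P)\<^sup>2 = 1"
    using arg_cong[OF P, of det] by (simp add: det_mul power2_eq_square)
  then have "\<bar>det P\<bar> = 1" by (simp add: power2_eq_1_iff abs_if) linarith
  moreover have "\<bar>det R\<bar> \<le> \<bar>det P\<bar>"
    using assms by (intro max) (auto simp: dot_square_norm power_le_one_iff)
  ultimately show ?thesis by simp
qed

lemma hadamard_inequality:
  fixes R :: "real ^ 'n ^ 'n"
  shows "\<bar>det R\<bar> \<le> (\<Prod>i\<in>UNIV. norm (R $ i))"
proof -
  define Q where "Q = (\<chi> i. (1 / norm (R $ i)) *\<^sub>R R $ i)"
  have "R = (\<chi> i. norm (R $ i) *s Q $ i)"
    by (auto simp: vec_eq_iff Q_def)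
  then have "det R = (\<Prod>i\<in>UNIV. norm (R $ i)) * det (\<chi> i. Q $ i)"
    using det_rows_mul[of "\<lambda>i. norm (R $ i)" "\<lambda>i. Q $ i"] by simp
  moreover have "\<bar>det Q\<bar> \<le> 1"
    by (rule abs_det_le_one) (simp add: Q_def)
  ultimately show ?thesis
    by (simp add: abs_mult abs_of_nonneg prod_nonneg mult_left_le)
qed

text \<open>The diagonal of \<open>R ** transpose R\<close> consists of the squared row lengths, so this is Hadamard's
  inequality followed by the inequality of the arithmetic and geometric means.\<close>
lemma trace_mult_transpose_ge_det:
  fixes R :: "real ^ 'n ^ 'n"
  shows "trace (R ** transpose R) \<ge> real CARD('n) * ((det R)\<^sup>2) powr (1 / real CARD('n))"
proof -
  have "((det R)\<^sup>2) powr (1 / real CARD('n)) \<le> (\<Prod>i\<in>UNIV. (norm (R $ i))\<^sup>2) powr (1 / real CARD('n))"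
    using power_mono[OF hadamard_inequality[of R], of 2]
    by (intro powr_mono2) (auto simp: prod_power_distrib)
  also have "\<dots> \<le> (\<Sum>i\<in>UNIV. (norm (R $ i))\<^sup>2 / real CARD('n))"
    by (rule arith_geom_mean) auto
  also have "\<dots> = trace (R ** transpose R) / real CARD('n)"
    by (simp add: trace_def matrix_matrix_mult_def transpose_def power2_norm_eq_inner inner_vec_def
        flip: sum_divide_distrib)
  finally show ?thesis by (simp add: field_simps)
qed

lemma pos_def_det_pos:
  assumes "pos_def (H :: real ^ 'n ^ 'n)"
  shows "det H > 0"
proof -
  obtain P where P: "P ** H ** transpose P = mat 1" "det P \<noteq> 0"
    using pos_def_congruent_identity[OF assms] by metis
  have "(det P)\<^sup>2 * det H = 1"
    using arg_cong[OF P(1), of det] by (simp add: det_mul power2_eq_square algebra_simps)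
  then show ?thesis
    by (metis zero_less_mult_pos zero_less_one zero_le_power2 zero_less_power2 mult_zero_left power_zero_numeral)
qed

text \<open>Choose \<open>P\<close> and \<open>Q\<close> that transform \<open>H\<close> and \<open>K\<close> into the identity and let \<open>Q'\<close> be the inverse
  of \<open>Q\<close>. With \<open>R = P ** Q'\<close> one has \<open>det_deriv H K = trace (R ** transpose R) * det H\<close>
  and \<open>(det R)\<^sup>2 = det K / det H\<close>.\<close>
lemma det_deriv_ge_pos_def:
  fixes H K :: "real ^ 'n ^ 'n"
  assumes H: "pos_def H" and K: "pos_def K"
  shows "det_deriv H K \<ge> real CARD('n) *
    (det K powr (1 / real CARD('n)) * det H powr ((real CARD('n) - 1) / real CARD('n)))"
proof -
  let ?n = "real CARD('n)"
  obtain P where P: "P ** H ** transpose P = mat 1" "det P \<noteq> 0"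
    using pos_def_congruent_identity[OF H] by metis
  obtain Q where Q: "Q ** K ** transpose Q = mat 1" "det Q \<noteq> 0"
    using pos_def_congruent_identity[OF K] by metis
  obtain Q' where Q': "Q ** Q' = mat 1" "Q' ** Q = mat 1"
    using Q(2) unfolding invertible_det_nz[symmetric] invertible_def by auto
  have dets: "(det P)\<^sup>2 * det H = 1" "(det Q)\<^sup>2 * det K = 1" "det Q' * det Q = 1"
    using arg_cong[OF P(1), of det] arg_cong[OF Q(1), of det] arg_cong[OF Q'(2), of det]
    by (simp_all add: det_mul power2_eq_square algebra_simps)
  have "(H ** transpose P) ** P = mat 1"
    using P(1) matrix_left_right_inverse[of P "H ** transpose P"] by (simp add: matrix_mul_assoc)
  then have "transpose ((H ** transpose P) ** P) = mat 1" by simp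
  then have inv: "transpose P ** P ** H = mat 1"
    using H by (simp add: matrix_transpose_mul pos_def_def matrix_mul_assoc)
  have Qt: "transpose Q ** transpose Q' = mat 1"
    using Q'(2) by (metis matrix_transpose_mul transpose_mat)
  have "K = (Q' ** Q) ** K ** (transpose Q ** transpose Q')"
    by (simp add: Qt Q')
  also have "\<dots> = Q' ** (Q ** K ** transpose Q) ** transpose Q'"
    by (simp add: matrix_mul_assoc)
  finally have K_eq: "K = Q' ** transpose Q'" by (simp add: Q)
  let ?R = "P ** Q'"
  have "det_deriv H K = det_deriv H ((K ** (transpose P ** P)) ** H)"
    using inv by (metis matrix_mul_assoc matrix_mul_rid)
  also have "\<dots> = trace (K ** transpose P ** P) * det H"
    by (simp add: det_deriv_mult matrix_mul_assoc)
  also have "trace (K ** transpose P ** P) = trace (P ** (K ** transpose P))"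
    by (rule trace_mul_sym)
  also have "P ** (K ** transpose P) = ?R ** transpose ?R"
    by (simp add: K_eq matrix_transpose_mul matrix_mul_assoc)
  finally have eq: "det_deriv H K = trace (?R ** transpose ?R) * det H" .
  have posH: "det H > 0" and posK: "det K > 0" using H K by (auto intro: pos_def_det_pos)
  have "(det ?R)\<^sup>2 = det K / det H"
  proof -
    have "(det P)\<^sup>2 = 1 / det H" "(det Q)\<^sup>2 = 1 / det K" "det Q' = 1 / det Q"
      using dets posH posK Q(2) by (simp_all add: field_simps)
    then show ?thesis by (simp add: det_mul power_mult_distrib power_divide)
  qed
  then have "?n * (det K / det H) powr (1 / ?n) * det H \<le> det_deriv H K"
    using trace_mult_transpose_ge_det[of ?R] posH unfolding eq by simp
  moreover have "(det K / det H) powr (1 / ?n) * det H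
      = det K powr (1 / ?n) * det H powr ((?n - 1) / ?n)"
  proof -
    have "(?n - 1) / ?n = 1 - 1 / ?n" by (simp add: field_simps)
    then show ?thesis using posH posK by (simp add: powr_divide powr_diff)
  qed
  ultimately show ?thesis by (simp add: mult.assoc)
qed

text \<open>Semidefinite matrices are limits of definite ones, which is how the inequality reaches Hessians
  of convex functions.\<close>
lemma pos_semidef_perturb:
  assumes "pos_semidef A" "e > 0"
  shows "pos_def (A + e *\<^sub>R mat 1)"
proof -
  have "transpose (A + e *\<^sub>R mat 1) = A + e *\<^sub>R mat 1"
    using assms by (auto simp: pos_semidef_def transpose_def vec_eq_iff mat_def)
  moreover have "0 < x \<bullet> ((A + e *\<^sub>R mat 1) *v x)" if "x \<noteq> 0" for x
  proof -
    have "(A + e *\<^sub>R mat 1) *v x = A *v x + e *\<^sub>R x"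
      by (simp add: matrix_vector_mult_add_rdistrib scaleR_matrix_vector_assoc[symmetric])
    moreover have "0 \<le> x \<bullet> (A *v x)" "0 < x \<bullet> x" using assms that by (auto simp: pos_semidef_def)
    ultimately show ?thesis using assms(2) by (simp add: inner_add_right add_nonneg_pos)
  qed
  ultimately show ?thesis by (simp add: pos_def_def)
qed

lemma tendsto_perturb:
  fixes A :: "real ^ 'n ^ 'n"
  shows "((\<lambda>e. A + e *\<^sub>R mat 1) \<longlongrightarrow> A) (at_right 0)"
  by (rule tendsto_eq_intros refl | simp)+

lemma tendsto_det [tendsto_intros]:
  fixes A :: "'a \<Rightarrow> real ^ 'n ^ 'n"
  assumes "(A \<longlongrightarrow> B) F"
  shows "((\<lambda>x. det (A x)) \<longlongrightarrow> det B) F"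
  unfolding det_def by (intro tendsto_intros assms)

lemma det_pos_semidef:
  assumes "pos_semidef (A :: real ^ 'n ^ 'n)"
  shows "det A \<ge> 0"
proof (rule tendsto_lowerbound)
  show "((\<lambda>e. det (A + e *\<^sub>R mat 1)) \<longlongrightarrow> det A) (at_right 0)"
    by (intro tendsto_intros tendsto_perturb)
  show "\<forall>\<^sub>F e in at_right 0. 0 \<le> det (A + e *\<^sub>R mat 1)"
    using eventually_at_right_less[of 0]
    by eventually_elim (use assms pos_semidef_perturb pos_def_det_pos in \<open>force intro: less_imp_le\<close>)
qed simp

lemma tendsto_replace_row:
  fixes A :: "'a \<Rightarrow> real ^ 'n ^ 'n"
  assumes "(A \<longlongrightarrow> B) F" "(x \<longlongrightarrow> y) F"
  shows "((\<lambda>t. replace_row i (x t) (A t)) \<longlongrightarrow> replace_row i y B) F"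
  unfolding replace_row_def
proof (rule tendsto_vec_lambda)
  show "((\<lambda>t. if k = i then x t else A t $ k) \<longlongrightarrow> (if k = i then y else B $ k)) F" for k
    by (cases "k = i") (auto intro!: tendsto_intros assms)
qed

lemma det_deriv_ge:
  fixes H K :: "real ^ 'n ^ 'n"
  assumes n: "CARD('n) \<ge> 2" and H: "pos_semidef H" and K: "pos_semidef K"
  shows "real CARD('n) * (det K powr (1 / real CARD('n))
    * det H powr ((real CARD('n) - 1) / real CARD('n))) \<le> det_deriv H K"
proof (rule tendsto_le)
  show "((\<lambda>e. det_deriv (H + e *\<^sub>R mat 1) (K + e *\<^sub>R mat 1)) \<longlongrightarrow> det_deriv H K) (at_right 0)"
    unfolding det_deriv_def
    by (intro tendsto_intros tendsto_replace_row tendsto_perturb)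
  show "((\<lambda>e. real CARD('n) * (det (K + e *\<^sub>R mat 1) powr (1 / real CARD('n))
      * det (H + e *\<^sub>R mat 1) powr ((real CARD('n) - 1) / real CARD('n))))
    \<longlongrightarrow> real CARD('n) * (det K powr (1 / real CARD('n))
      * det H powr ((real CARD('n) - 1) / real CARD('n)))) (at_right 0)"
  proof -
    have ev: "\<forall>\<^sub>F e in at_right 0. 0 \<le> det (A + e *\<^sub>R mat 1)" if "pos_semidef A" for A :: "real ^ 'n ^ 'n"
      using eventually_at_right_less[of 0]
      by eventually_elim (use that pos_semidef_perturb pos_def_det_pos in \<open>force intro: less_imp_le\<close>)
    show ?thesis
      using n by (intro tendsto_mult tendsto_const tendsto_powr' tendsto_det tendsto_perturb
          disjI2 conjI ev H K) simp_all
  qed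
  show "\<forall>\<^sub>F e in at_right 0. real CARD('n) * (det (K + e *\<^sub>R mat 1) powr (1 / real CARD('n))
      * det (H + e *\<^sub>R mat 1) powr ((real CARD('n) - 1) / real CARD('n)))
    \<le> det_deriv (H + e *\<^sub>R mat 1) (K + e *\<^sub>R mat 1)"
    using eventually_at_right_less[of 0]
    by eventually_elim (intro det_deriv_ge_pos_def pos_semidef_perturb H K)
qed simp

section \<open>Integration by parts for compactly supported functions\<close>

text \<open>Translation invariance of Lebesgue measure makes the integral of every difference quotient of
  \<open>F\<close> zero. The quotients converge to \<open>F'\<close>, and since \<open>F\<close> is Lipschitz along \<open>e\<close> with compact support they
  are dominated by a constant on a ball.\<close>
lemma integral_directional_derivative_eq_0:
  fixes F F' :: "'a::euclidean_space \<Rightarrow> real"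
  assumes K: "compact K" and F: "continuous_on UNIV F" and F': "continuous_on UNIV F'"
    and deriv: "\<And>x. ((\<lambda>t. F (x + t *\<^sub>R e)) has_real_derivative F' x) (at 0)"
    and zero: "\<And>x. x \<notin> K \<Longrightarrow> F x = 0" "\<And>x. x \<notin> K \<Longrightarrow> F' x = 0"
  shows "integral\<^sup>L lborel F' = 0"
proof -
  have supp: "(\<lambda>x. indicator K x *\<^sub>R F x) = F" "(\<lambda>x. indicator K x *\<^sub>R F' x) = F'"
    using zero by (auto simp: fun_eq_iff indicator_def)
  have intF: "integrable lborel F"
    using borel_integrable_compact[OF K continuous_on_subset[OF F subset_UNIV]] by (simp only: supp)
  have "bounded (F' ` K)"
    by (intro compact_imp_bounded compact_continuous_image K continuous_on_subset[OF F']) auto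
  then obtain B where B: "B > 0" "\<And>x. x \<in> K \<Longrightarrow> \<bar>F' x\<bar> \<le> B"
    by (auto simp: bounded_pos)
  have bound: "\<bar>F' x\<bar> \<le> B" for x using B zero(2)[of x] by (cases "x \<in> K") auto
  have deriv': "((\<lambda>t. F (x + t *\<^sub>R e)) has_real_derivative F' (x + t *\<^sub>R e)) (at t)" for x t
  proof -
    have "((\<lambda>s. F (x + (s + t) *\<^sub>R e)) has_real_derivative F' (x + t *\<^sub>R e)) (at 0)"
      using deriv[of "x + t *\<^sub>R e"] by (simp add: algebra_simps)
    then show ?thesis using DERIV_shift[of "\<lambda>t. F (x + t *\<^sub>R e)" "F' (x + t *\<^sub>R e)" 0 t] by simp
  qed
  have lipschitz: "\<bar>F (x + t *\<^sub>R e) - F x\<bar> \<le> B * t" if t: "t > 0" for x t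
  proof -
    obtain z where "F (x + t *\<^sub>R e) - F (x + 0 *\<^sub>R e) = (t - 0) * F' (x + z *\<^sub>R e)"
      using MVT2[OF t, of "\<lambda>t. F (x + t *\<^sub>R e)" "\<lambda>t. F' (x + t *\<^sub>R e)"] deriv' by blast
    then show ?thesis using bound[of "x + z *\<^sub>R e"] t by (simp add: abs_mult mult.commute)
  qed
  obtain r where r: "\<And>x. x \<in> K \<Longrightarrow> norm x \<le> r"
    using compact_imp_bounded[OF K] by (auto simp: bounded_iff)
  define h where "h k = 1 / real (Suc k)" for k
  have h: "h k > 0" "h k \<le> 1" for k by (auto simp: h_def)
  define q where "q k x = (F (x + h k *\<^sub>R e) - F x) / h k" for k x
  have translate: "integrable lborel (\<lambda>x. F (x + c))" "(\<integral>x. F (x + c) \<partial>lborel) = (\<integral>x. F x \<partial>lborel)" for c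
  proof -
    have meas: "(+) c \<in> measurable lborel borel" by simp
    have "F \<in> borel_measurable borel" using F by (rule borel_measurable_continuous_onI)
    then show "integrable lborel (\<lambda>x. F (x + c))" "(\<integral>x. F (x + c) \<partial>lborel) = (\<integral>x. F x \<partial>lborel)"
      using integrable_distr_eq[OF meas, of F] integral_distr[OF meas, of F] intF
      by (simp_all add: lborel_distr_plus add.commute)
  qed
  have "(\<lambda>k. integral\<^sup>L lborel (q k)) \<longlonglongrightarrow> integral\<^sup>L lborel F'"
  proof (rule integral_dominated_convergence[where w = "\<lambda>x. indicator (cball 0 (r + norm e)) x *\<^sub>R B"])
    show "F' \<in> borel_measurable lborel" using F' by (simp add: borel_measurable_continuous_onI)
    show "q k \<in> borel_measurable lborel" for k
      unfolding q_def using borel_measurable_integrable[OF translate(1)] borel_measurable_integrable[OF intF]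
      by measurable
    show "integrable lborel (\<lambda>x. indicator (cball 0 (r + norm e)) x *\<^sub>R B)"
      by (intro borel_integrable_compact) auto
    have "(\<lambda>k. q k x) \<longlonglongrightarrow> F' x" for x
    proof -
      have "((\<lambda>t. (F (x + t *\<^sub>R e) - F x) / t) \<longlongrightarrow> F' x) (at 0)"
        using deriv[of x] by (simp add: has_field_derivative_iff)
      moreover have "filterlim h (at 0) sequentially"
        using LIMSEQ_inverse_real_of_nat h unfolding h_def filterlim_at
        by (auto simp: inverse_eq_divide intro!: always_eventually)
      ultimately show ?thesis unfolding q_def by (rule filterlim_compose)
    qed
    then show "AE x in lborel. (\<lambda>k. q k x) \<longlonglongrightarrow> F' x" by simp
    have "\<bar>q k x\<bar> \<le> indicator (cball 0 (r + norm e)) x *\<^sub>R B" for k x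
    proof (cases "norm x \<le> r + norm e")
      case True
      then show ?thesis
        using lipschitz[OF h(1), of x k] h[of k] by (simp add: q_def abs_divide field_simps)
    next
      case False
      have "norm x \<le> norm (x + h k *\<^sub>R e) + norm (h k *\<^sub>R e)"
        by (metis add_diff_cancel_right' norm_triangle_ineq4)
      also have "norm (h k *\<^sub>R e) \<le> norm e" using h[of k] by (simp add: mult_left_le_one_le)
      finally have "norm x \<le> norm (x + h k *\<^sub>R e) + norm e" by simp
      moreover have "norm e \<ge> 0" by simp
      ultimately have "x + h k *\<^sub>R e \<notin> K" "x \<notin> K"
        using False r[of x] r[of "x + h k *\<^sub>R e"] by linarith+
      then show ?thesis using B(1) by (simp add: q_def zero)
    qed
    then show "AE x in lborel. norm (q k x) \<le> indicator (cball 0 (r + norm e)) x *\<^sub>R B" for k by simp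
  qed
  moreover have "integral\<^sup>L lborel (q k) = 0" for k
    unfolding q_def using translate[of "h k *\<^sub>R e"] intF by simp
  ultimately show ?thesis by (simp add: LIMSEQ_const_iff)
qed

text \<open>For \<open>g\<close> that is defined by a formula on \<open>\<Omega>\<close> only and vanishes there outside \<open>K\<close>: the extension
  agrees with \<open>g\<close> on the open set \<open>\<Omega>\<close> and with \<open>0\<close> on the open set \<open>- K\<close>, and these two cover
  the space.\<close>
lemma continuous_on_extend_by_zero:
  fixes g :: "'a::t2_space \<Rightarrow> real"
  assumes "open \<Omega>" "compact K" "K \<subseteq> \<Omega>" "continuous_on \<Omega> g" "\<And>x. x \<in> \<Omega> - K \<Longrightarrow> g x = 0"
  shows "continuous_on UNIV (\<lambda>x. indicator \<Omega> x * g x)"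
proof -
  have "continuous_on (\<Omega> \<union> - K) (\<lambda>x. indicator \<Omega> x * g x)"
  proof (rule continuous_on_open_Un)
    show "continuous_on \<Omega> (\<lambda>x. indicator \<Omega> x * g x)"
      using assms(4) by (rule continuous_on_eq) simp
    have "continuous_on (- K) (\<lambda>x. 0 :: real)" by simp
    then show "continuous_on (- K) (\<lambda>x. indicator \<Omega> x * g x)"
      by (rule continuous_on_eq) (use assms(5) in \<open>auto simp: indicator_def\<close>)
  qed (use assms compact_imp_closed in auto)
  also have "\<Omega> \<union> - K = UNIV" using assms(3) by auto
  finally show ?thesis .
qed

lemma integrable_extend_by_zero:
  fixes g :: "'a::euclidean_space \<Rightarrow> real"
  assumes "open \<Omega>" "compact K" "K \<subseteq> \<Omega>" "continuous_on \<Omega> g" "\<And>x. x \<in> \<Omega> - K \<Longrightarrow> g x = 0"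
  shows "integrable lborel (\<lambda>x. indicator \<Omega> x * g x)"
proof -
  have "integrable lborel (\<lambda>x. indicator K x *\<^sub>R (indicator \<Omega> x * g x))"
    by (intro borel_integrable_compact assms continuous_on_subset[OF continuous_on_extend_by_zero[OF assms]]) auto
  also have "(\<lambda>x. indicator K x *\<^sub>R (indicator \<Omega> x * g x)) = (\<lambda>x. indicator \<Omega> x * g x)"
    using assms(5) by (auto simp: indicator_def fun_eq_iff)
  finally show ?thesis .
qed

text \<open>Partial derivatives as derivatives along coordinate lines: the product and chain rules, and the
  derivative of a determinant, are then those of one-variable calculus.\<close>
definition has_partial :: "'n \<Rightarrow> (real ^ 'n \<Rightarrow> real) \<Rightarrow> real \<Rightarrow> real ^ 'n \<Rightarrow> bool" where
  "has_partial i f d x \<longleftrightarrow> ((\<lambda>t. f (x + t *\<^sub>R axis i 1)) has_real_derivative d) (at 0)"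

lemma has_partial_cong:
  assumes "open S" "x \<in> S" "\<And>y. y \<in> S \<Longrightarrow> f y = g y"
  shows "has_partial i f d x \<longleftrightarrow> has_partial i g d x"
proof -
  have "isCont (\<lambda>t. x + t *\<^sub>R axis i 1) 0" by (intro continuous_intros)
  then have "\<forall>\<^sub>F t in nhds 0. x + t *\<^sub>R axis i 1 \<in> S"
    using assms(1,2) unfolding continuous_at tendsto_def eventually_nhds_conv_at by auto
  then have "\<forall>\<^sub>F t in nhds 0. f (x + t *\<^sub>R axis i 1) = g (x + t *\<^sub>R axis i 1)"
    by eventually_elim (rule assms(3))
  then show ?thesis unfolding has_partial_def by (intro DERIV_cong_ev) auto
qed

text \<open>Green's identity for the operator with coefficients \<open>A\<close>. The difference of the two integrands is
  the divergence of the compactly supported field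
  \<open>\<Sum>j. A i j * (p * u1 j - u * p1 j)\<close>: the terms with derivatives of \<open>A\<close> cancel because the
  columns of \<open>A\<close> are divergence free, and those with two first derivatives because \<open>A\<close> is
  symmetric.\<close>
lemma integral_divergence_form_symmetric:
  fixes A dA u2 p2 :: "'n \<Rightarrow> 'n \<Rightarrow> real ^ 'n \<Rightarrow> real"
  assumes \<Omega>: "open \<Omega>" "compact K" "K \<subseteq> \<Omega>"
    and cont: "\<And>i j. continuous_on \<Omega> (A i j)" "\<And>i j. continuous_on \<Omega> (dA i j)"
      "continuous_on \<Omega> u" "\<And>i. continuous_on \<Omega> (u1 i)" "\<And>i j. continuous_on \<Omega> (u2 i j)"
      "continuous_on \<Omega> p" "\<And>i. continuous_on \<Omega> (p1 i)" "\<And>i j. continuous_on \<Omega> (p2 i j)"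
    and dA: "\<And>i j x. x \<in> \<Omega> \<Longrightarrow> has_partial i (A i j) (dA i j x) x"
    and u: "\<And>i x. x \<in> \<Omega> \<Longrightarrow> has_partial i u (u1 i x) x"
      "\<And>i j x. x \<in> \<Omega> \<Longrightarrow> has_partial i (u1 j) (u2 i j x) x"
    and p: "\<And>i x. x \<in> \<Omega> \<Longrightarrow> has_partial i p (p1 i x) x"
      "\<And>i j x. x \<in> \<Omega> \<Longrightarrow> has_partial i (p1 j) (p2 i j x) x"
    and zero: "\<And>x. x \<in> \<Omega> - K \<Longrightarrow> p x = 0" "\<And>i x. x \<in> \<Omega> - K \<Longrightarrow> p1 i x = 0"
      "\<And>i j x. x \<in> \<Omega> - K \<Longrightarrow> p2 i j x = 0"
    and sym: "\<And>i j x. x \<in> \<Omega> \<Longrightarrow> A i j x = A j i x"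
    and div_free: "\<And>j x. x \<in> \<Omega> \<Longrightarrow> (\<Sum>i\<in>UNIV. dA i j x) = 0"
  shows "(\<integral>x. indicator \<Omega> x * (p x * (\<Sum>i\<in>UNIV. \<Sum>j\<in>UNIV. A i j x * u2 i j x)) \<partial>lborel)
       = (\<integral>x. indicator \<Omega> x * (u x * (\<Sum>i\<in>UNIV. \<Sum>j\<in>UNIV. A i j x * p2 i j x)) \<partial>lborel)"
proof -
  define f where "f i x = (\<Sum>j\<in>UNIV. A i j x * (p x * u1 j x - u x * p1 j x))" for i x
  define f' where "f' i x = (\<Sum>j\<in>UNIV. dA i j x * (p x * u1 j x - u x * p1 j x)
    + A i j x * ((p1 i x * u1 j x + p x * u2 i j x) - (u1 i x * p1 j x + u x * p2 i j x)))" for i x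
  have contf: "continuous_on \<Omega> (f i)" "continuous_on \<Omega> (f' i)" for i
    unfolding f_def f'_def by (intro continuous_intros cont)+
  have zerof: "f i x = 0" "f' i x = 0" if "x \<in> \<Omega> - K" for i x
    using zero[OF that] by (auto simp: f_def f'_def)
  have deriv: "has_partial i (\<lambda>x. indicator \<Omega> x * f i x) (indicator \<Omega> x * f' i x) x" for i x
  proof (cases "x \<in> \<Omega>")
    case True
    have "has_partial i (f i) (f' i x) x"
      unfolding f_def f'_def has_partial_def
    proof (rule DERIV_sum)
      fix j
      note D = DERIV_mult[OF dA[OF True, of i j, unfolded has_partial_def]
          DERIV_diff[OF
            DERIV_mult[OF p(1)[OF True, of i, unfolded has_partial_def] u(2)[OF True, of i j, unfolded has_partial_def]]
            DERIV_mult[OF u(1)[OF True, of i, unfolded has_partial_def] p(2)[OF True, of i j, unfolded has_partial_def]]]]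
      show "((\<lambda>t. A i j (x + t *\<^sub>R axis i 1) * (p (x + t *\<^sub>R axis i 1) * u1 j (x + t *\<^sub>R axis i 1)
            - u (x + t *\<^sub>R axis i 1) * p1 j (x + t *\<^sub>R axis i 1)))
          has_real_derivative dA i j x * (p x * u1 j x - u x * p1 j x)
            + A i j x * (p1 i x * u1 j x + p x * u2 i j x - (u1 i x * p1 j x + u x * p2 i j x))) (at 0)"
        by (rule DERIV_cong[OF D]) (simp add: algebra_simps)
    qed
    also have "?this \<longleftrightarrow> has_partial i (\<lambda>x. indicator \<Omega> x * f i x) (f' i x) x"
      using \<Omega>(1) True by (rule has_partial_cong) simp
    finally show ?thesis using True by simp
  next
    case False
    have "has_partial i (\<lambda>x. 0) 0 x" by (simp add: has_partial_def)
    also have "?this \<longleftrightarrow> has_partial i (\<lambda>x. indicator \<Omega> x * f i x) 0 x"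
      using \<Omega> False zerof compact_imp_closed[OF \<Omega>(2)]
      by (intro has_partial_cong[of "- K"]) (auto simp: indicator_def open_Compl)
    finally show ?thesis using False by simp
  qed
  have int0: "(\<integral>x. indicator \<Omega> x * f' i x \<partial>lborel) = 0" for i
    using \<Omega> contf zerof deriv[unfolded has_partial_def]
    by (intro integral_directional_derivative_eq_0[of K "\<lambda>x. indicator \<Omega> x * f i x" _ "axis i 1"]
        continuous_on_extend_by_zero[of \<Omega> K]) (auto simp: indicator_def)
  have intf: "integrable lborel (\<lambda>x. indicator \<Omega> x * f' i x)" for i
    using \<Omega> contf zerof by (intro integrable_extend_by_zero[of \<Omega> K]) auto
  let ?U = "\<lambda>x. p x * (\<Sum>i\<in>UNIV. \<Sum>j\<in>UNIV. A i j x * u2 i j x)"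
  let ?P = "\<lambda>x. u x * (\<Sum>i\<in>UNIV. \<Sum>j\<in>UNIV. A i j x * p2 i j x)"
  have div: "(\<Sum>i\<in>UNIV. f' i x) = ?U x - ?P x" if "x \<in> \<Omega>" for x
  proof -
    have "(\<Sum>i\<in>UNIV. \<Sum>j\<in>UNIV. dA i j x * (p x * u1 j x - u x * p1 j x)) = 0"
      by (subst sum.swap) (simp add: div_free[OF that] flip: sum_distrib_right)
    moreover have "(\<Sum>i\<in>UNIV. \<Sum>j\<in>UNIV. A i j x * (p1 i x * u1 j x))
        = (\<Sum>i\<in>UNIV. \<Sum>j\<in>UNIV. A i j x * (u1 i x * p1 j x))"
      by (subst sum.swap) (simp add: sym[OF that] mult.commute)
    ultimately show ?thesis
      by (simp add: f'_def sum.distrib sum_subtractf algebra_simps sum_distrib_left)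
  qed
  have "(\<integral>x. indicator \<Omega> x * ?U x \<partial>lborel) - (\<integral>x. indicator \<Omega> x * ?P x \<partial>lborel)
      = (\<integral>x. indicator \<Omega> x * ?U x - indicator \<Omega> x * ?P x \<partial>lborel)"
    using \<Omega> zero
    by (intro Bochner_Integration.integral_diff[symmetric] integrable_extend_by_zero[of \<Omega> K] continuous_intros cont) auto
  also have "\<dots> = (\<integral>x. (\<Sum>i\<in>UNIV. indicator \<Omega> x * f' i x) \<partial>lborel)"
    by (intro Bochner_Integration.integral_cong refl) (auto simp: indicator_def div)
  also have "\<dots> = 0"
    using intf by (subst Bochner_Integration.integral_sum) (simp_all only: int0 sum.neutral_const)
  finally show ?thesis by simp
qed

section \<open>Hessians of smooth and of convex functions\<close>

lemma C_on_imp_continuous_on: "C_on k S f \<Longrightarrow> continuous_on S f"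
  by (cases k) (auto intro!: continuous_at_imp_continuous_on differentiable_imp_continuous_within)

lemma C_on_le: "C_on k S f \<Longrightarrow> j \<le> k \<Longrightarrow> C_on j S f"
proof (induction j arbitrary: k f)
  case 0
  then show ?case by (auto intro: C_on_imp_continuous_on)
next
  case (Suc j)
  then obtain k' where "k = Suc k'" by (cases k) auto
  with Suc show ?case by auto
qed

lemma C_on_partial_deriv: "C_on (Suc k) S f \<Longrightarrow> C_on k S (partial_deriv i f)"
  by (simp add: partial_deriv_def[abs_def])

lemma C_on_line_deriv:
  assumes "C_on (Suc k) S (f :: real ^ 'n \<Rightarrow> real)" "x + t *\<^sub>R d \<in> S"
  shows "((\<lambda>t. f (x + t *\<^sub>R d)) has_real_derivative frechet_derivative f (at (x + t *\<^sub>R d)) d) (at t)"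
proof -
  let ?D = "frechet_derivative f (at (x + t *\<^sub>R d))"
  have D: "(f has_derivative ?D) (at (x + t *\<^sub>R d))"
    using assms by (simp add: frechet_derivative_works[symmetric])
  have "((\<lambda>t. x + t *\<^sub>R d) has_derivative (\<lambda>t. t *\<^sub>R d)) (at t)"
    by (auto intro!: derivative_eq_intros)
  then have "((\<lambda>t. f (x + t *\<^sub>R d)) has_derivative (\<lambda>t. ?D (t *\<^sub>R d))) (at t)"
    using D by (rule has_derivative_compose)
  moreover have "(\<lambda>t. ?D (t *\<^sub>R d)) = (*) (?D d)"
    using linear_scale[OF has_derivative_linear[OF D]] by (auto simp: fun_eq_iff)
  ultimately show ?thesis by (simp add: has_field_derivative_def)
qed

lemma C_on_partial_line:
  assumes "C_on (Suc k) S f" "x + t *\<^sub>R axis i 1 \<in> S"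
  shows "((\<lambda>t. f (x + t *\<^sub>R axis i 1)) has_real_derivative partial_deriv i f (x + t *\<^sub>R axis i 1)) (at t)"
  unfolding partial_deriv_def by (rule C_on_line_deriv[OF assms])

lemma C_on_has_partial:
  assumes "C_on (Suc k) S f" "x \<in> S"
  shows "has_partial i f (partial_deriv i f x) x"
  unfolding has_partial_def using C_on_partial_line[OF assms(1), of x 0 i] assms(2) by simp

lemma frechet_derivative_eq_sum_partial:
  assumes "C_on (Suc k) S (f :: real ^ 'n \<Rightarrow> real)" "x \<in> S"
  shows "frechet_derivative f (at x) d = (\<Sum>j\<in>UNIV. d $ j * partial_deriv j f x)"
proof -
  have lin: "linear (frechet_derivative f (at x))"
    using assms frechet_derivative_works has_derivative_linear by fastforce
  have "frechet_derivative f (at x) (\<Sum>j\<in>UNIV. d $ j *\<^sub>R axis j 1)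
      = (\<Sum>j\<in>UNIV. d $ j * partial_deriv j f x)"
    by (simp add: linear_sum[OF lin] linear_scale[OF lin] partial_deriv_def)
  then show ?thesis by (simp add: basis_expansion flip: scalar_mult_eq_scaleR)
qed

text \<open>The mean value theorem is applied in direction \<open>i\<close> and then in direction \<open>j\<close>. The left-hand
  side is symmetric in \<open>i\<close> and \<open>j\<close>, which is what gives the equality of mixed derivatives.\<close>
lemma second_difference_eq_partial_deriv:
  assumes f: "C_on 2 S f" and h: "h > 0" and S: "cball x (2 * h) \<subseteq> S"
  obtains p where "dist x p \<le> 2 * h"
    "f (x + h *\<^sub>R axis i 1 + h *\<^sub>R axis j 1) - f (x + h *\<^sub>R axis i 1) - f (x + h *\<^sub>R axis j 1) + f x
      = h * h * partial_deriv j (partial_deriv i f) p"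
proof -
  have f': "C_on (Suc 1) S f" using f by (simp add: numeral_2_eq_2)
  have f1: "C_on (Suc 0) S (partial_deriv i f)" using C_on_partial_deriv[OF f'] by simp
  let ?a = "axis i 1 :: real ^ 'a" and ?b = "axis j 1 :: real ^ 'a"
  have near: "dist x (x + s *\<^sub>R ?a + t *\<^sub>R ?b) \<le> 2 * h" if "0 \<le> s" "s \<le> h" "0 \<le> t" "t \<le> h" for s t
  proof -
    have "norm (s *\<^sub>R ?a + t *\<^sub>R ?b) \<le> s + t"
      using that by (intro order.trans[OF norm_triangle_ineq]) simp
    moreover have "dist x (x + s *\<^sub>R ?a + t *\<^sub>R ?b) = norm (s *\<^sub>R ?a + t *\<^sub>R ?b)"
      by (subst dist_commute) (simp add: dist_norm add.assoc)
    ultimately show ?thesis using that by linarith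
  qed
  then have inS: "x + s *\<^sub>R ?a + t *\<^sub>R ?b \<in> S" if "0 \<le> s" "s \<le> h" "0 \<le> t" "t \<le> h" for s t
    using that S by auto
  define g where "g s = f (x + h *\<^sub>R ?b + s *\<^sub>R ?a) - f (x + s *\<^sub>R ?a)" for s
  have "\<exists>z>0. z < h \<and> g h - g 0 = (h - 0) *
      (partial_deriv i f (x + h *\<^sub>R ?b + z *\<^sub>R ?a) - partial_deriv i f (x + z *\<^sub>R ?a))"
    unfolding g_def
  proof (rule MVT2[OF h], rule DERIV_diff)
    fix s assume s: "0 \<le> s" "s \<le> h"
    show "((\<lambda>s. f (x + h *\<^sub>R ?b + s *\<^sub>R ?a)) has_real_derivative partial_deriv i f (x + h *\<^sub>R ?b + s *\<^sub>R ?a)) (at s)"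
      using inS[OF s, of h] h by (intro C_on_partial_line[OF f']) (simp add: algebra_simps)
    show "((\<lambda>s. f (x + s *\<^sub>R ?a)) has_real_derivative partial_deriv i f (x + s *\<^sub>R ?a)) (at s)"
      using inS[OF s, of 0] h by (intro C_on_partial_line[OF f']) simp
  qed
  then obtain z where z: "0 < z" "z < h" and gz: "g h - g 0 = h *
      (partial_deriv i f (x + h *\<^sub>R ?b + z *\<^sub>R ?a) - partial_deriv i f (x + z *\<^sub>R ?a))" by auto
  have "\<exists>y>0. y < h \<and> partial_deriv i f (x + z *\<^sub>R ?a + h *\<^sub>R ?b) - partial_deriv i f (x + z *\<^sub>R ?a + 0 *\<^sub>R ?b)
      = (h - 0) * partial_deriv j (partial_deriv i f) (x + z *\<^sub>R ?a + y *\<^sub>R ?b)"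
    using inS z by (intro MVT2[OF h] C_on_partial_line[OF f1]) auto
  then obtain y where y: "0 < y" "y < h"
    and gy: "partial_deriv i f (x + z *\<^sub>R ?a + h *\<^sub>R ?b) - partial_deriv i f (x + z *\<^sub>R ?a)
      = h * partial_deriv j (partial_deriv i f) (x + z *\<^sub>R ?a + y *\<^sub>R ?b)" by auto
  show thesis
  proof
    show "dist x (x + z *\<^sub>R ?a + y *\<^sub>R ?b) \<le> 2 * h" using near z y by simp
    have "x + h *\<^sub>R ?b + z *\<^sub>R ?a = x + z *\<^sub>R ?a + h *\<^sub>R ?b" "x + h *\<^sub>R ?b + h *\<^sub>R ?a = x + h *\<^sub>R ?a + h *\<^sub>R ?b"
      by simp_all
    then show "f (x + h *\<^sub>R ?a + h *\<^sub>R ?b) - f (x + h *\<^sub>R ?a) - f (x + h *\<^sub>R ?b) + f x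
      = h * h * partial_deriv j (partial_deriv i f) (x + z *\<^sub>R ?a + y *\<^sub>R ?b)"
      using gz gy unfolding g_def by (simp add: algebra_simps)
  qed
qed

text \<open>The same second difference, at every small scale, is \<open>h\<^sup>2\<close> times a value of either mixed
  derivative near \<open>x\<close>; by continuity the two agree at \<open>x\<close>.\<close>
lemma partial_deriv_commute:
  assumes S: "open S" "x \<in> S" and f: "C_on 2 S f"
  shows "partial_deriv i (partial_deriv j f) x = partial_deriv j (partial_deriv i f) x"
proof (rule ccontr)
  let ?p = "partial_deriv i (partial_deriv j f)" and ?q = "partial_deriv j (partial_deriv i f)"
  assume neq: "?p x \<noteq> ?q x"
  have f': "C_on (Suc (Suc 0)) S f" using f by (simp add: numeral_2_eq_2)
  have "isCont ?p x" "isCont ?q x"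
    using S C_on_partial_deriv[OF C_on_partial_deriv[OF f']]
    by (auto simp: continuous_on_eq_continuous_at)
  moreover have "\<bar>?p x - ?q x\<bar> / 2 > 0" using neq by simp
  ultimately obtain d e where d: "d > 0" "\<And>y. dist y x < d \<Longrightarrow> dist (?p y) (?p x) < \<bar>?p x - ?q x\<bar> / 2"
    and e: "e > 0" "\<And>y. dist y x < e \<Longrightarrow> dist (?q y) (?q x) < \<bar>?p x - ?q x\<bar> / 2"
    unfolding continuous_at_eps_delta by metis
  obtain r where r: "r > 0" "cball x r \<subseteq> S" using S open_contains_cball by blast
  define h where "h = min r (min d e) / 3"
  have h: "h > 0" "2 * h \<le> r" "2 * h < d" "2 * h < e" using d(1) e(1) r(1) by (auto simp: h_def)
  have "cball x (2 * h) \<subseteq> S" using r h by auto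
  note second_difference = second_difference_eq_partial_deriv[OF f h(1) this]
  obtain y z where dist: "dist x y \<le> 2 * h" "dist x z \<le> 2 * h" and eq: "h * h * ?p y = h * h * ?q z"
  proof -
    obtain z where z: "dist x z \<le> 2 * h"
      "f (x + h *\<^sub>R axis i 1 + h *\<^sub>R axis j 1) - f (x + h *\<^sub>R axis i 1) - f (x + h *\<^sub>R axis j 1) + f x = h * h * ?q z"
      using second_difference by blast
    obtain y where y: "dist x y \<le> 2 * h"
      "f (x + h *\<^sub>R axis j 1 + h *\<^sub>R axis i 1) - f (x + h *\<^sub>R axis j 1) - f (x + h *\<^sub>R axis i 1) + f x = h * h * ?p y"
      using second_difference by blast
    have "x + h *\<^sub>R axis j 1 + h *\<^sub>R axis i 1 = x + h *\<^sub>R axis i 1 + h *\<^sub>R axis j 1"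
      by (simp add: add_ac)
    from y(2)[unfolded this] z(2) have "h * h * ?p y = h * h * ?q z" by linarith
    then show thesis using that y(1) z(1) by blast
  qed
  have "dist (?p y) (?p x) < \<bar>?p x - ?q x\<bar> / 2" "dist (?q z) (?q x) < \<bar>?p x - ?q x\<bar> / 2"
    using d(2)[of y] e(2)[of z] h dist by (simp_all add: dist_commute)
  moreover have "?p y = ?q z" using eq h by simp
  ultimately show False by (simp add: dist_real_def) argo
qed

lemma hessian_nth: "hessian f x $ i $ j = partial_deriv i (partial_deriv j f) x"
  by (simp add: hessian_def)

lemma hessian_symmetric:
  assumes "open S" "x \<in> S" "C_on 2 S f"
  shows "transpose (hessian f x) = hessian f x"
  using partial_deriv_commute[OF assms] by (simp add: transpose_def vec_eq_iff hessian_nth)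

lemma continuous_on_hessian:
  assumes "C_on 2 S (f :: real ^ 'n \<Rightarrow> real)"
  shows "continuous_on S (hessian f)"
proof -
  have "C_on (Suc (Suc 0)) S f" using assms by (simp add: numeral_2_eq_2)
  then have "continuous_on S (\<lambda>x. partial_deriv i (partial_deriv j f) x)" for i j
    using C_on_imp_continuous_on[OF C_on_partial_deriv[OF C_on_partial_deriv]] by blast
  then show ?thesis unfolding hessian_def[abs_def] by (intro continuous_on_vec_lambda)
qed

text \<open>If the second derivative in some direction \<open>d\<close> were negative at \<open>x\<close>, it would be negative on a
  whole segment around \<open>x\<close>. By the mean value theorem, the second difference
  \<open>f (x + s d) + f (x - s d) - 2 f x\<close> is a positive multiple of a value of it, hence negative,
  against midpoint convexity.\<close>
lemma pos_semidef_hessian: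
  assumes S: "open S" "x \<in> S" and f: "C_on 2 S f" and conv: "convex_on S f"
  shows "pos_semidef (hessian f x)"
proof -
  have f': "C_on (Suc (Suc 0)) S f" using f by (simp add: numeral_2_eq_2)
  have "0 \<le> d \<bullet> (hessian f x *v d)" for d
  proof (rule ccontr)
    assume neg: "\<not> 0 \<le> d \<bullet> (hessian f x *v d)"
    define g1 where "g1 y = (\<Sum>j\<in>UNIV. d $ j * partial_deriv j f y)" for y
    define g2 where "g2 y = d \<bullet> (hessian f y *v d)" for y
    have line: "isCont (\<lambda>t. x + t *\<^sub>R d) 0" by (intro continuous_intros)
    have "continuous_on S g2"
      unfolding g2_def matrix_vector_mult_def inner_vec_def
      using continuous_on_hessian[OF f] by (intro continuous_intros) auto
    then have "isCont g2 x" using S continuous_on_eq_continuous_at by blast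
    then have "isCont (\<lambda>t. g2 (x + t *\<^sub>R d)) 0"
      using line continuous_at_compose[of 0 "\<lambda>t. x + t *\<^sub>R d" g2] by (simp add: o_def)
    then have "((\<lambda>t. g2 (x + t *\<^sub>R d)) \<longlongrightarrow> g2 x) (at 0)"
      by (simp add: isCont_def)
    moreover have "g2 x < 0" using neg by (simp add: g2_def)
    ultimately have "\<forall>\<^sub>F t in nhds 0. g2 (x + t *\<^sub>R d) < 0"
      unfolding eventually_nhds_conv_at by (auto dest: order_tendstoD(2))
    moreover have "\<forall>\<^sub>F t in nhds 0. x + t *\<^sub>R d \<in> S"
      using line S unfolding isCont_def eventually_nhds_conv_at by (auto dest: topological_tendstoD)
    ultimately have "\<forall>\<^sub>F t in nhds (0::real). g2 (x + t *\<^sub>R d) < 0 \<and> x + t *\<^sub>R d \<in> S"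
      by (rule eventually_conj)
    then obtain r where r: "r > 0" and near: "\<And>t. \<bar>t\<bar> < r \<Longrightarrow> g2 (x + t *\<^sub>R d) < 0 \<and> x + t *\<^sub>R d \<in> S"
      unfolding eventually_nhds_metric by (auto simp: dist_real_def)
    \<comment> \<open>\<open>g1\<close> and \<open>g2\<close> are the first and second derivatives of \<open>f\<close> along \<open>d\<close>\<close>
    have D1: "((\<lambda>t. f (x + t *\<^sub>R d)) has_real_derivative g1 (x + t *\<^sub>R d)) (at t)" if "\<bar>t\<bar> < r" for t
      using C_on_line_deriv[OF f', of x t d] frechet_derivative_eq_sum_partial[OF f', of "x + t *\<^sub>R d" d] near[OF that]
      by (simp add: g1_def)
    have D2: "((\<lambda>t. g1 (x + t *\<^sub>R d)) has_real_derivative g2 (x + t *\<^sub>R d)) (at t)" if "\<bar>t\<bar> < r" for t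
    proof -
      have "((\<lambda>t. g1 (x + t *\<^sub>R d)) has_real_derivative
          (\<Sum>j\<in>UNIV. d $ j * (\<Sum>i\<in>UNIV. d $ i * partial_deriv i (partial_deriv j f) (x + t *\<^sub>R d)))) (at t)"
        unfolding g1_def
      proof (intro DERIV_sum DERIV_cmult)
        fix j
        have fj: "C_on (Suc 0) S (partial_deriv j f)" using C_on_partial_deriv[OF f'] .
        show "((\<lambda>t. partial_deriv j f (x + t *\<^sub>R d)) has_real_derivative
            (\<Sum>i\<in>UNIV. d $ i * partial_deriv i (partial_deriv j f) (x + t *\<^sub>R d))) (at t)"
          using C_on_line_deriv[OF fj, of x t d] frechet_derivative_eq_sum_partial[OF fj, of "x + t *\<^sub>R d" d] near[OF that]
          by simp
      qed
      also have "(\<Sum>j\<in>UNIV. d $ j * (\<Sum>i\<in>UNIV. d $ i * partial_deriv i (partial_deriv j f) (x + t *\<^sub>R d)))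
          = g2 (x + t *\<^sub>R d)"
        unfolding g2_def matrix_vector_mult_def inner_vec_def sum_distrib_left
        by (subst sum.swap) (simp add: hessian_nth mult_ac sum_distrib_left)
      finally show ?thesis .
    qed
    define s where "s = r / 2"
    have s: "0 < s" "s < r" using r by (auto simp: s_def)
    have "\<exists>z>0. z < s \<and> (f (x + s *\<^sub>R d) + f (x + (- s) *\<^sub>R d)) - (f (x + 0 *\<^sub>R d) + f (x + (- 0) *\<^sub>R d))
        = (s - 0) * (g1 (x + z *\<^sub>R d) + - g1 (x + (- z) *\<^sub>R d))"
    proof (rule MVT2[OF s(1)], rule DERIV_add)
      fix t assume t: "0 \<le> t" "t \<le> s"
      show "((\<lambda>t. f (x + t *\<^sub>R d)) has_real_derivative g1 (x + t *\<^sub>R d)) (at t)" using t s by (intro D1) auto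
      have "((\<lambda>t. f (x + t *\<^sub>R d)) has_real_derivative g1 (x + (- t) *\<^sub>R d)) (at (- t))" using t s by (intro D1) auto
      moreover have "(uminus has_real_derivative -1) (at t)" by (auto intro!: derivative_eq_intros)
      ultimately have "((\<lambda>t. f (x + (- t) *\<^sub>R d)) has_real_derivative g1 (x + (- t) *\<^sub>R d) * -1) (at t)"
        by (rule DERIV_chain2[where f = "\<lambda>t. f (x + t *\<^sub>R d)" and g = uminus])
      then
      show "((\<lambda>t. f (x + (- t) *\<^sub>R d)) has_real_derivative - g1 (x + (- t) *\<^sub>R d)) (at t)"
        by simp
    qed
    then obtain z where z: "0 < z" "z < s" and fz: "f (x + s *\<^sub>R d) + f (x + (- s) *\<^sub>R d) - 2 * f x
        = s * (g1 (x + z *\<^sub>R d) - g1 (x + (- z) *\<^sub>R d))" by auto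
    have "\<exists>w>-z. w < z \<and> g1 (x + z *\<^sub>R d) - g1 (x + (- z) *\<^sub>R d) = (z - (- z)) * g2 (x + w *\<^sub>R d)"
      using z s by (intro MVT2[of "- z" z "\<lambda>t. g1 (x + t *\<^sub>R d)"] D2) auto
    then obtain w where w: "- z < w" "w < z"
      and gw: "g1 (x + z *\<^sub>R d) - g1 (x + (- z) *\<^sub>R d) = 2 * z * g2 (x + w *\<^sub>R d)" by auto
    have "g2 (x + w *\<^sub>R d) < 0" using near[of w] w z s by auto
    then have "f (x + s *\<^sub>R d) + f (x + (- s) *\<^sub>R d) - 2 * f x < 0"
      unfolding fz gw using s z by (simp add: mult_pos_neg)
    moreover have "f x \<le> (1 - 1/2) * f (x + s *\<^sub>R d) + (1/2) * f (x + (- s) *\<^sub>R d)"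
    proof -
      have "x = (1 - 1/2) *\<^sub>R (x + s *\<^sub>R d) + (1/2) *\<^sub>R (x + (- s) *\<^sub>R d)"
        by (simp add: vec_eq_iff field_simps)
      then show ?thesis
        using convex_onD[OF conv, of "1/2" "x + s *\<^sub>R d" "x + (- s) *\<^sub>R d"] near[of s] near[of "- s"] s by simp
    qed
    ultimately show False by simp
  qed
  then show ?thesis using hessian_symmetric[OF S f] by (simp add: pos_semidef_def)
qed

section \<open>A convex cutoff function\<close>

text \<open>At the joint both one-sided derivatives vanish.\<close>
lemma DERIV_max_0:
  fixes h h' :: "real \<Rightarrow> real"
  assumes deriv: "\<And>s. s \<ge> 0 \<Longrightarrow> (h has_real_derivative h' s) (at s)" and zero: "h 0 = 0" "h' 0 = 0"
  shows "((\<lambda>s. h (max 0 s)) has_real_derivative h' (max 0 s)) (at s)"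
proof (rule linorder_cases[of s 0])
  assume s: "s < 0"
  then have "\<forall>\<^sub>F t in nhds s. h (max 0 t) = 0"
    using eventually_nhds_in_open[of "{..<0}" s] zero by (auto elim!: eventually_mono)
  then have "((\<lambda>t. h (max 0 t)) has_real_derivative 0) (at s) \<longleftrightarrow> ((\<lambda>t. 0) has_real_derivative 0) (at s)"
    by (intro DERIV_cong_ev) auto
  then show ?thesis using s zero by simp
next
  assume s: "s > 0"
  then have "\<forall>\<^sub>F t in nhds s. h (max 0 t) = h t"
    using eventually_nhds_in_open[of "{0<..}" s] by (auto elim!: eventually_mono simp: max_def)
  then have "((\<lambda>t. h (max 0 t)) has_real_derivative h' s) (at s) \<longleftrightarrow> (h has_real_derivative h' s) (at s)"
    by (intro DERIV_cong_ev) auto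
  then show ?thesis using s deriv[of s] by simp
next
  assume s: "s = 0"
  have "((\<lambda>t. h t / t) \<longlongrightarrow> 0) (at 0)"
    using deriv[of 0] zero by (simp add: has_field_derivative_iff)
  then have "((\<lambda>t. \<bar>h t / t\<bar>) \<longlongrightarrow> 0) (at 0)" by (rule tendsto_rabs_zero)
  then have "((\<lambda>t. h (max 0 t) / t) \<longlongrightarrow> 0) (at 0)"
  proof (rule Lim_null_comparison[rotated])
    have "norm (h (max 0 t) / t) \<le> \<bar>h t / t\<bar>" for t
    proof (cases "t \<ge> 0")
      case False
      then have "norm (h (max 0 t) / t) = 0" using zero by (simp add: max_def)
      then show ?thesis using abs_ge_zero[of "h t / t"] by linarith
    qed (simp add: max_def)
    then show "\<forall>\<^sub>F t in at 0. norm (h (max 0 t) / t) \<le> \<bar>h t / t\<bar>" by simp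
  qed
  then show ?thesis using s zero by (simp add: has_field_derivative_iff)
qed

text \<open>For \<open>h s = s - arctan s\<close> one has \<open>h' s = s\<^sup>2 / (1 + s\<^sup>2)\<close>, which lies in \<open>[0,1]\<close>, is increasing for
  \<open>s \<ge> 0\<close> and vanishes to second order at \<open>0\<close>. So \<open>h\<close>, glued to the zero function, is convex, of class
  \<open>C\<^sup>2\<close> and of slope at most \<open>1\<close>; it is shifted to vanish for \<open>t \<le> 1 / k\<close> and scaled so that the
  functions converge to the identity on \<open>t \<ge> 0\<close> as \<open>k\<close> grows.\<close>
definition cutoff :: "real \<Rightarrow> real \<Rightarrow> real" where
  "cutoff k t = (let s = max 0 (k * t - 1) in (s - arctan s) / k)"

definition cutoff' :: "real \<Rightarrow> real \<Rightarrow> real" where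
  "cutoff' k t = (let s = max 0 (k * t - 1) in s\<^sup>2 / (1 + s\<^sup>2))"

definition cutoff'' :: "real \<Rightarrow> real \<Rightarrow> real" where
  "cutoff'' k t = (let s = max 0 (k * t - 1) in k * (2 * s / (1 + s\<^sup>2)\<^sup>2))"

lemma one_plus_square_neq_0: "1 + s\<^sup>2 \<noteq> (0::real)"
  by (smt (verit) zero_le_power2)

lemma cutoff_deriv:
  assumes "k > 0"
  shows "(cutoff k has_real_derivative cutoff' k t) (at t)"
    and "(cutoff' k has_real_derivative cutoff'' k t) (at t)"
proof -
  have line: "((\<lambda>t. k * t - 1) has_real_derivative k) (at t)" by (auto intro!: derivative_eq_intros)
  have d1: "((\<lambda>s. s - arctan s) has_real_derivative s\<^sup>2 / (1 + s\<^sup>2)) (at s)" for s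
    by (auto intro!: derivative_eq_intros simp: divide_simps one_plus_square_neq_0)
  have d2: "((\<lambda>s. s\<^sup>2 / (1 + s\<^sup>2)) has_real_derivative 2 * s / (1 + s\<^sup>2)\<^sup>2) (at s)" for s :: real
    using one_plus_square_neq_0[of s]
    by (auto intro!: derivative_eq_intros simp: power2_eq_square algebra_simps)
  have m1: "((\<lambda>s. max 0 s - arctan (max 0 s)) has_real_derivative (max 0 s)\<^sup>2 / (1 + (max 0 s)\<^sup>2)) (at s)" for s
    by (rule DERIV_max_0) (use d1 in auto)
  have m2: "((\<lambda>s. (max 0 s)\<^sup>2 / (1 + (max 0 s)\<^sup>2)) has_real_derivative 2 * max 0 s / (1 + (max 0 s)\<^sup>2)\<^sup>2) (at s)" for s :: real
    by (rule DERIV_max_0) (use d2 in auto)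
  show "(cutoff k has_real_derivative cutoff' k t) (at t)"
    using DERIV_cdivide[OF DERIV_chain2[OF m1 line], of k] assms
    unfolding cutoff_def[abs_def] cutoff'_def Let_def by simp
  show "(cutoff' k has_real_derivative cutoff'' k t) (at t)"
    using DERIV_chain2[OF m2 line]
    unfolding cutoff'_def[abs_def] cutoff''_def Let_def by (simp add: mult.commute)
qed

lemma cutoff_eq_0:
  assumes "k * t \<le> 1"
  shows "cutoff k t = 0" "cutoff' k t = 0" "cutoff'' k t = 0"
  using assms by (simp_all add: cutoff_def cutoff'_def cutoff''_def)

lemma cutoff_bounds:
  assumes "k > 0"
  shows "cutoff k t \<ge> 0" "0 \<le> cutoff' k t" "cutoff' k t \<le> 1" "cutoff'' k t \<ge> 0"
proof -
  have "arctan s \<le> s" if "s \<ge> 0" for s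
  proof (cases "s = 0")
    case False
    then have "\<exists>z>0. z < s \<and> (s - arctan s) - (0 - arctan 0) = (s - 0) * (z\<^sup>2 / (1 + z\<^sup>2))"
      using that by (intro MVT2)
        (auto intro!: derivative_eq_intros simp: divide_simps one_plus_square_neq_0)
    then obtain z where "s - arctan s = s * (z\<^sup>2 / (1 + z\<^sup>2))" by auto
    moreover have "s * (z\<^sup>2 / (1 + z\<^sup>2)) \<ge> 0" using that by simp
    ultimately show ?thesis by linarith
  qed simp
  then show "cutoff k t \<ge> 0" using assms by (simp add: cutoff_def Let_def)
  show "0 \<le> cutoff' k t" "cutoff' k t \<le> 1" "cutoff'' k t \<ge> 0"
    using assms by (auto simp: cutoff'_def cutoff''_def Let_def divide_le_eq_1 add_pos_nonneg)
qed

lemma continuous_on_cutoff: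
  assumes "k > 0"
  shows "continuous_on S (cutoff k)" "continuous_on S (cutoff' k)" "continuous_on S (cutoff'' k)"
proof -
  show "continuous_on S (cutoff k)" "continuous_on S (cutoff' k)"
    using cutoff_deriv[OF assms] by (meson continuous_at_imp_continuous_on DERIV_isCont)+
  show "continuous_on S (cutoff'' k)"
    unfolding cutoff''_def[abs_def] Let_def
    by (intro continuous_intros) (simp_all add: one_plus_square_neq_0)
qed

lemma cutoff_tendsto:
  assumes "t \<ge> 0"
  shows "(\<lambda>m. cutoff (real (Suc m)) t) \<longlonglongrightarrow> t"
proof -
  have "\<bar>cutoff k t - t\<bar> \<le> (1 + pi / 2) * (1 / k)" if k: "k > 0" for k
  proof (cases "k * t \<le> 1")
    case True
    then have "t \<le> 1 / k" using k by (simp add: field_simps)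
    also have "\<dots> \<le> (1 + pi / 2) * (1 / k)" using k by (simp add: field_simps)
    finally show ?thesis using True assms by (simp add: cutoff_eq_0)
  next
    case False
    then have "cutoff k t - t = - (1 + arctan (k * t - 1)) * (1 / k)"
      using k by (simp add: cutoff_def field_simps)
    moreover have "\<bar>- (1 + arctan (k * t - 1))\<bar> \<le> 1 + pi / 2"
      using arctan_bounded[of "k * t - 1"] False zero_le_arctan_iff[of "k * t - 1"] by linarith
    ultimately show ?thesis using k by (simp add: abs_mult divide_right_mono)
  qed
  then have "\<forall>m. norm (cutoff (real (Suc m)) t - t) \<le> (1 + pi / 2) * (1 / real (Suc m))" by simp
  moreover have "(\<lambda>m. (1 + pi / 2) * (1 / real (Suc m))) \<longlonglongrightarrow> (1 + pi / 2) * 0"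
    using LIMSEQ_inverse_real_of_nat by (intro tendsto_mult tendsto_const) (simp add: inverse_eq_divide)
  ultimately have "(\<lambda>m. cutoff (real (Suc m)) t - t) \<longlonglongrightarrow> 0"
    unfolding mult_zero_right by (rule Lim_null_comparison[OF always_eventually])
  then show ?thesis by (rule LIM_zero_cancel)
qed

section \<open>The cofactor matrix of a Hessian\<close>

lemma has_partial_chain:
  assumes "(g has_real_derivative D) (at (f x))" "has_partial i f d x"
  shows "has_partial i (\<lambda>x. g (f x)) (D * d) x"
  using DERIV_chain2[of g D "\<lambda>t. f (x + t *\<^sub>R axis i 1)" 0 d] assms by (simp add: has_partial_def)

definition cofactor :: "(real ^ 'n \<Rightarrow> real) \<Rightarrow> 'n \<Rightarrow> 'n \<Rightarrow> real ^ 'n \<Rightarrow> real" where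
  "cofactor v i j x = det (replace_row i (axis j 1) (hessian v x))"

text \<open>The derivative of \<open>cofactor v i j\<close> in direction \<open>i\<close>. The sum omits row \<open>i\<close>, which is the constant
  vector \<open>axis j 1\<close>.\<close>
definition cofactor_deriv :: "(real ^ 'n \<Rightarrow> real) \<Rightarrow> 'n \<Rightarrow> 'n \<Rightarrow> real ^ 'n \<Rightarrow> real" where
  "cofactor_deriv v i j x = (\<Sum>k\<in>UNIV - {i}.
     det (replace_row k (\<chi> l. partial_deriv i (partial_deriv k (partial_deriv l v)) x)
       (replace_row i (axis j 1) (hessian v x))))"

lemma has_partial_cofactor:
  assumes v: "C_on 3 S v" and x: "x \<in> S"
  shows "has_partial i (cofactor v i j) (cofactor_deriv v i j x) x"
proof -
  have v': "C_on (Suc (Suc (Suc 0))) S v" using v by (simp add: numeral_3_eq_3)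
  define M where "M t = replace_row i (axis j 1) (hessian v (x + t *\<^sub>R axis i 1))" for t :: real
  define T where "T k = (\<chi> l. partial_deriv i (partial_deriv k (partial_deriv l v)) x)" for k
  define B where "B = (\<chi> k. if k = i then 0 else T k)"
  have "((\<lambda>t. det (M t)) has_real_derivative det_deriv (M 0) B) (at 0)"
  proof (rule det_has_real_derivative)
    fix k l
    show "((\<lambda>t. M t $ k $ l) has_real_derivative B $ k $ l) (at 0)"
    proof (cases "k = i")
      case False
      have "C_on (Suc 0) S (partial_deriv k (partial_deriv l v))"
        by (intro C_on_partial_deriv v')
      from C_on_has_partial[OF this x, of i] show ?thesis
        using False by (simp add: M_def B_def T_def has_partial_def replace_row_def hessian_nth)
    qed (simp add: M_def B_def replace_row_def)
  qed
  moreover have "det_deriv (M 0) B = cofactor_deriv v i j x"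
  proof -
    have "replace_row i 0 (M 0) = replace_row i 0 (hessian v x)"
      by (simp add: M_def replace_row_def vec_eq_iff)
    then have "det (replace_row i 0 (M 0)) = 0"
      using det_replace_row_scale[of i 0 0 "hessian v x"] by simp
    then show ?thesis
      unfolding det_deriv_def cofactor_deriv_def
      by (subst sum.remove[of UNIV i]) (auto simp: B_def T_def M_def intro!: sum.cong)
  qed
  ultimately show ?thesis by (simp add: has_partial_def cofactor_def M_def)
qed

text \<open>The third derivatives of \<open>v\<close> are symmetric in \<open>i\<close> and \<open>k\<close>, so the terms cancel in pairs.\<close>
lemma cofactor_divergence_free:
  assumes S: "open S" "x \<in> S" and v: "C_on 3 S v"
  shows "(\<Sum>i\<in>UNIV. cofactor_deriv v i j x) = 0"
  unfolding cofactor_deriv_def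
proof (rule sum_det_replace_two_rows_symmetric)
  fix i k
  have "C_on (Suc (Suc 0)) S (partial_deriv l v)" for l
    using v by (intro C_on_partial_deriv) (simp add: numeral_3_eq_3)
  then show "(\<chi> l. partial_deriv i (partial_deriv k (partial_deriv l v)) x)
      = (\<chi> l. partial_deriv k (partial_deriv i (partial_deriv l v)) x)"
    using S by (simp add: vec_eq_iff partial_deriv_commute[of S] numeral_2_eq_2)
qed

lemma cofactor_symmetric:
  assumes "open S" "x \<in> S" "C_on 2 S v"
  shows "cofactor v i j x = cofactor v j i x"
  unfolding cofactor_def by (subst det_replace_row_axis_transpose) (simp add: hessian_symmetric[OF assms])

lemma continuous_on_replace_row [continuous_intros]:
  fixes A :: "'a::topological_space \<Rightarrow> real ^ 'n ^ 'n"
  assumes "continuous_on S A" "continuous_on S x"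
  shows "continuous_on S (\<lambda>t. replace_row i (x t) (A t))"
  unfolding replace_row_def
proof (rule continuous_on_vec_lambda)
  show "continuous_on S (\<lambda>t. if k = i then x t else A t $ k)" for k
    by (cases "k = i") (auto intro!: continuous_intros assms)
qed

lemma continuous_on_cofactor:
  assumes "C_on 3 S v"
  shows "continuous_on S (cofactor v i j)" "continuous_on S (cofactor_deriv v i j)"
proof -
  have H: "continuous_on S (hessian v)"
    using C_on_le[OF assms, of 2] by (intro continuous_on_hessian) simp
  have T: "continuous_on S (\<lambda>x. \<chi> l. partial_deriv i (partial_deriv k (partial_deriv l v)) x)" for k
    using assms
    by (intro continuous_on_vec_lambda C_on_imp_continuous_on[of 0] C_on_partial_deriv) (simp add: numeral_3_eq_3)
  show "continuous_on S (cofactor v i j)" "continuous_on S (cofactor_deriv v i j)"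
    unfolding cofactor_def[abs_def] cofactor_deriv_def[abs_def]
    by (intro continuous_intros H T)+
qed

lemma sum_cofactor_mult:
  "(\<Sum>i\<in>UNIV. \<Sum>j\<in>UNIV. cofactor v i j x * B $ i $ j) = det_deriv (hessian v x) B"
  by (simp add: det_deriv_expand cofactor_def mult.commute)

section \<open>The integral inequality\<close>

text \<open>If \<open>u\<close> were positive somewhere, its maximum over the closure would be attained at a point \<open>y\<close> of
  \<open>\<Omega>\<close>. A convex function with an interior maximum is constant, so \<open>0\<close> is a subgradient at \<open>y\<close>, and
  strict convexity makes \<open>u\<close> larger than \<open>u y\<close> at the other points.\<close>
lemma strictly_convex_nonpos:
  fixes u :: "real ^ 'n \<Rightarrow> real"
  assumes \<Omega>: "bounded \<Omega>" "open \<Omega>" and u: "continuous_on (closure \<Omega>) u"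
    and conv: "strictly_convex_on \<Omega> u" and bdry: "\<forall>x\<in>frontier \<Omega>. u x = 0" and x: "x \<in> \<Omega>"
  shows "u x \<le> 0"
proof (rule ccontr)
  assume pos: "\<not> u x \<le> 0"
  have "\<exists>y\<in>closure \<Omega>. \<forall>z\<in>closure \<Omega>. u z \<le> u y"
    using \<Omega>(1) u x closure_subset by (intro continuous_attains_sup) auto
  then obtain y where y: "y \<in> closure \<Omega>" and max: "\<And>z. z \<in> closure \<Omega> \<Longrightarrow> u z \<le> u y" by blast
  have "u x \<le> u y" using x closure_subset by (intro max) auto
  moreover have "u y = 0" if "y \<notin> \<Omega>"
    using that bdry y \<Omega>(2) by (auto simp: frontier_def interior_open)
  ultimately have y\<Omega>: "y \<in> \<Omega>" using pos by linarith
  obtain r where r: "r > 0" "ball y r \<subseteq> \<Omega>" using \<Omega>(2) y\<Omega> open_contains_ball by blast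
  have convex: "convex_on \<Omega> u" using conv by (simp add: strictly_convex_on_def)
  have const: "u z = u y" if z: "z \<in> \<Omega>" for z
  proof (rule antisym)
    show "u z \<le> u y" using z closure_subset by (intro max) auto
    \<comment> \<open>\<open>t\<close> is small enough for the point opposite to \<open>z\<close>, at distance \<open>t * norm (z - y)\<close> from \<open>y\<close>, to stay in \<open>\<Omega>\<close>\<close>
    define t where "t = r / (r + norm (z - y) + 1)"
    have den: "r + norm (z - y) + 1 > 0" using r(1) by (simp add: add_pos_nonneg)
    have t: "t > 0" "t * norm (z - y) < r"
    proof -
      show "t > 0" using r(1) den by (simp add: t_def)
      have "r * norm (z - y) < r * (r + norm (z - y) + 1)" using r(1) by simp
      then show "t * norm (z - y) < r" using den by (simp add: t_def field_simps)
    qed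
    let ?y' = "y - t *\<^sub>R (z - y)"
    have "?y' \<in> ball y r" using t by (simp add: dist_norm)
    then have y': "?y' \<in> \<Omega>" using r by auto
    define s where "s = t / (1 + t)"
    have s: "0 < s" "s < 1" using t by (auto simp: s_def field_simps)
    have "s * (1 + t) = t" using t by (simp add: s_def)
    moreover have "(1 - s) *\<^sub>R ?y' + s *\<^sub>R z - y = (s * (1 + t) - t) *\<^sub>R (z - y)"
      by (simp add: algebra_simps)
    ultimately have "y = (1 - s) *\<^sub>R ?y' + s *\<^sub>R z" by simp
    then have "u y \<le> (1 - s) * u ?y' + s * u z"
      using convex_onD[OF convex, of s ?y' z] s y' z by simp
    also have "\<dots> \<le> (1 - s) * u y + s * u z"
      using s y' closure_subset max[of ?y'] by (intro add_right_mono mult_left_mono) auto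
    finally show "u y \<le> u z" using s by (simp add: algebra_simps)
  qed
  then have "0 \<in> subdifferential \<Omega> u y" by (simp add: subdifferential_def)
  moreover have z: "y + (r / 2) *\<^sub>R axis undefined 1 \<in> \<Omega> - {y}"
  proof -
    have "y + (r / 2) *\<^sub>R axis undefined 1 \<in> ball y r" using r(1) by (simp add: dist_norm)
    then show ?thesis using r by (auto simp: axis_eq_0_iff)
  qed
  ultimately have "u (y + (r / 2) *\<^sub>R axis undefined 1) > u y + 0 \<bullet> (y + (r / 2) *\<^sub>R axis undefined 1 - y)"
    using conv y\<Omega> unfolding strictly_convex_on_def by blast
  then show False using const[of "y + (r / 2) *\<^sub>R axis undefined 1"] z by simp
qed

text \<open>The left-hand side subtracts the negative part of \<open>f\<close>; the right-hand side ignores it.\<close>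
lemma ennreal_integral_le_nn_integral:
  assumes "integrable M (f :: 'a \<Rightarrow> real)"
  shows "ennreal (integral\<^sup>L M f) \<le> (\<integral>\<^sup>+x. ennreal (f x) \<partial>M)"
proof -
  have int: "integrable M (\<lambda>x. max 0 (f x))" using assms by simp
  have "ennreal (integral\<^sup>L M f) \<le> ennreal (\<integral>x. max 0 (f x) \<partial>M)"
    by (intro ennreal_leI integral_mono assms int) simp
  also have "\<dots> = (\<integral>\<^sup>+x. ennreal (max 0 (f x)) \<partial>M)"
    using int by (intro nn_integral_eq_integral[symmetric]) auto
  also have "\<dots> = (\<integral>\<^sup>+x. ennreal (f x) \<partial>M)"
    by (simp add: max_def ennreal_neg cong: if_cong)
      (auto intro!: nn_integral_cong simp: ennreal_neg)
  finally show ?thesis .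
qed

text \<open>The theorem with \<open>\<bar>v\<bar>\<close> replaced by \<open>p = cutoff k (- v)\<close>, which vanishes outside the compact set
  \<open>K\<close> where \<open>v \<le> - 1 / k\<close>. Green's identity equates the integrals of \<open>a = p * L u\<close> and
  \<open>b = u * L p\<close>; the matrix inequality bounds \<open>a\<close> from below, and convexity of the cutoff with
  \<open>u \<le> 0\<close> bounds \<open>b\<close> from above.\<close>
lemma cutoff_integral_inequality:
  fixes \<Omega> :: "(real ^ 'n) set" and u v :: "real ^ 'n \<Rightarrow> real"
  assumes n: "CARD('n) \<ge> 2" and \<Omega>: "bounded \<Omega>" "open \<Omega>"
    and contv: "continuous_on (closure \<Omega>) v" and u: "C_on 2 \<Omega> u" and v: "C_on 3 \<Omega> v"
    and conv: "convex_on \<Omega> u" "convex_on \<Omega> v" and nonpos: "\<And>x. x \<in> \<Omega> \<Longrightarrow> u x \<le> 0"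
    and bdry: "\<forall>x\<in>frontier \<Omega>. v x = 0" and k: "k > 0"
  shows "(\<integral>\<^sup>+x\<in>\<Omega>. ennreal (cutoff k (- v x) * (det (hessian u x) powr (1 / real CARD('n))
            * det (hessian v x) powr ((real CARD('n) - 1) / real CARD('n)))) \<partial>lborel)
       \<le> (\<integral>\<^sup>+x\<in>\<Omega>. ennreal (\<bar>u x\<bar> * det (hessian v x)) \<partial>lborel)"
proof -
  let ?n = "real CARD('n)"
  define r where "r x = det (hessian u x) powr (1 / ?n) * det (hessian v x) powr ((?n - 1) / ?n)" for x
  have v2: "C_on 2 \<Omega> v" using C_on_le[OF v] by simp
  have sucs: "C_on (Suc (Suc 0)) \<Omega> u" "C_on (Suc (Suc 0)) \<Omega> v"
    using u v2 by (simp_all add: numeral_2_eq_2)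
  have sucs1: "C_on (Suc 0) \<Omega> (partial_deriv j u)" "C_on (Suc 0) \<Omega> (partial_deriv j v)" for j
    using sucs[THEN C_on_partial_deriv] by blast+
  have cont2: "continuous_on \<Omega> (partial_deriv i (partial_deriv j u))"
    "continuous_on \<Omega> (partial_deriv i (partial_deriv j v))" for i j
    using C_on_imp_continuous_on[OF C_on_partial_deriv[OF sucs1(1)]]
      C_on_imp_continuous_on[OF C_on_partial_deriv[OF sucs1(2)]] by blast+
  have cont1: "continuous_on \<Omega> (partial_deriv j u)" "continuous_on \<Omega> (partial_deriv j v)" for j
    using sucs1[THEN C_on_imp_continuous_on] by blast+
  have cont0: "continuous_on \<Omega> u" "continuous_on \<Omega> v"
    using u v by (blast intro: C_on_imp_continuous_on)+
  have psd: "pos_semidef (hessian u x)" "pos_semidef (hessian v x)" if "x \<in> \<Omega>" for x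
    using that \<Omega> u v2 conv by (auto intro!: pos_semidef_hessian[of \<Omega>])

  define K where "K = {x \<in> closure \<Omega>. v x \<le> - (1 / k)}"
  have "closed K"
    unfolding K_def using contv by (intro continuous_on_closed_Collect_le continuous_on_const) auto
  moreover have "bounded K"
    by (rule bounded_subset[OF bounded_closure[OF \<Omega>(1)]]) (auto simp: K_def)
  ultimately have compK: "compact K" by (simp add: compact_eq_bounded_closed)
  have K_sub: "K \<subseteq> \<Omega>"
  proof
    fix x assume x: "x \<in> K"
    show "x \<in> \<Omega>"
    proof (rule ccontr)
      assume "x \<notin> \<Omega>"
      then have "x \<in> frontier \<Omega>" using x \<Omega>(2) by (auto simp: K_def frontier_def interior_open)
      then show False using x bdry k by (auto simp: K_def)
    qed
  qed
  have small: "k * - v x \<le> 1" if "x \<in> \<Omega> - K" for x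
  proof -
    have "v x > - (1 / k)" using that closure_subset[of \<Omega>] by (auto simp: K_def)
    then show ?thesis using k by (simp add: field_simps)
  qed

  define p where "p x = cutoff k (- v x)" for x
  define p1 where "p1 j x = cutoff' k (- v x) * - partial_deriv j v x" for j x
  define p2 where "p2 i j x = cutoff'' k (- v x) * (partial_deriv i v x * partial_deriv j v x)
    - cutoff' k (- v x) * partial_deriv i (partial_deriv j v) x" for i j x
  have neg_partial: "has_partial i (\<lambda>x. - f x) (- d) x" if "has_partial i f d x" for i x d and f :: "real ^ 'n \<Rightarrow> real"
    using that unfolding has_partial_def by (rule DERIV_minus)
  have p1: "has_partial i p (p1 i x) x" if "x \<in> \<Omega>" for i x
    unfolding p_def p1_def
    by (intro has_partial_chain cutoff_deriv k neg_partial C_on_has_partial[OF sucs(2)] that)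
  have p2: "has_partial i (p1 j) (p2 i j x) x" if x: "x \<in> \<Omega>" for i j x
  proof -
    have "has_partial i (\<lambda>x. cutoff' k (- v x)) (cutoff'' k (- v x) * - partial_deriv i v x) x"
      by (intro has_partial_chain cutoff_deriv k neg_partial C_on_has_partial[OF sucs(2)] x)
    moreover have "has_partial i (\<lambda>x. - partial_deriv j v x) (- partial_deriv i (partial_deriv j v) x) x"
      by (intro neg_partial C_on_has_partial[OF sucs1(2)] x)
    ultimately show ?thesis
      unfolding has_partial_def p1_def p2_def
      by (rule DERIV_cong[OF DERIV_mult]) (simp add: algebra_simps)
  qed
  have contneg: "continuous_on \<Omega> (\<lambda>x. - v x)" by (intro continuous_intros cont0)
  have contc: "continuous_on \<Omega> (\<lambda>x. cutoff k (- v x))" "continuous_on \<Omega> (\<lambda>x. cutoff' k (- v x))"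
    "continuous_on \<Omega> (\<lambda>x. cutoff'' k (- v x))"
    using continuous_on_cutoff[OF k, of UNIV, THEN continuous_on_compose2, OF contneg subset_UNIV] .
  have contp: "continuous_on \<Omega> p" "continuous_on \<Omega> (p1 j)" "continuous_on \<Omega> (p2 i j)" for i j
    unfolding p_def[abs_def] p1_def[abs_def] p2_def[abs_def]
    by (rule contc, (intro continuous_intros contc cont1 cont2)+)

  define a where "a x = p x * det_deriv (hessian v x) (hessian u x)" for x
  define b where "b x = u x * det_deriv (hessian v x) (\<chi> i j. p2 i j x)" for x
  have a_eq: "a x = p x * (\<Sum>i\<in>UNIV. \<Sum>j\<in>UNIV. cofactor v i j x * partial_deriv i (partial_deriv j u) x)"
    and b_eq: "b x = u x * (\<Sum>i\<in>UNIV. \<Sum>j\<in>UNIV. cofactor v i j x * p2 i j x)" for x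
    unfolding a_def b_def sum_cofactor_mult[symmetric] by (simp_all add: hessian_nth)
  have int_eq: "(\<integral>x. indicator \<Omega> x * a x \<partial>lborel) = (\<integral>x. indicator \<Omega> x * b x \<partial>lborel)"
    unfolding a_eq b_eq
  proof (rule integral_divergence_form_symmetric[OF \<Omega>(2) compK K_sub,
        where dA = "cofactor_deriv v" and ?u1.0 = "\<lambda>j. partial_deriv j u" and ?p1.0 = p1])
    show "has_partial i (cofactor v i j) (cofactor_deriv v i j x) x" if "x \<in> \<Omega>" for i j x
      using v that by (rule has_partial_cofactor)
    show "has_partial i u (partial_deriv i u x) x" if "x \<in> \<Omega>" for i x
      using sucs(1) that by (rule C_on_has_partial)
    show "has_partial i (partial_deriv j u) (partial_deriv i (partial_deriv j u) x) x" if "x \<in> \<Omega>" for i j x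
      using sucs1(1) that by (rule C_on_has_partial)
    show "p x = 0" "p1 j x = 0" "p2 i j x = 0" if "x \<in> \<Omega> - K" for i j x
      using cutoff_eq_0[OF small[OF that]] by (simp_all add: p_def p1_def p2_def)
    show "cofactor v i j x = cofactor v j i x" if "x \<in> \<Omega>" for i j x
      using \<Omega>(2) that v2 by (rule cofactor_symmetric)
    show "(\<Sum>i\<in>UNIV. cofactor_deriv v i j x) = 0" if "x \<in> \<Omega>" for j x
      using \<Omega>(2) that v by (rule cofactor_divergence_free)
  qed (fact continuous_on_cofactor[OF v] cont0 cont1 cont2 contp p1 p2)+
  have zero: "a x = 0" "b x = 0" if "x \<in> \<Omega> - K" for x
    using cutoff_eq_0[OF small[OF that]] unfolding a_eq b_eq by (simp_all add: p_def p2_def)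
  have int: "integrable lborel (\<lambda>x. indicator \<Omega> x * a x)" "integrable lborel (\<lambda>x. indicator \<Omega> x * b x)"
    using zero
    by (auto intro!: integrable_extend_by_zero[OF \<Omega>(2) compK K_sub] continuous_intros
        continuous_on_cofactor[OF v] cont0 cont2 contp simp: a_eq[abs_def] b_eq[abs_def])

  have a_ge: "?n * (p x * r x) \<le> a x" if "x \<in> \<Omega>" for x
  proof -
    have "p x * (?n * r x) \<le> a x"
      unfolding a_def r_def p_def
      by (intro mult_left_mono det_deriv_ge n psd that cutoff_bounds k)
    then show ?thesis by (simp add: mult.left_commute)
  qed
  have b_le: "b x \<le> ?n * (\<bar>u x\<bar> * det (hessian v x))" if x: "x \<in> \<Omega>" for x
  proof -
    let ?g = "\<chi> i. partial_deriv i v x" and ?w = "- v x"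
    let ?G = "(\<chi> i j. ?g $ i * ?g $ j) :: real ^ 'n ^ 'n"
    \<comment> \<open>the contribution of the second derivative of the cutoff has a sign because \<open>?G\<close>, the
      square of the gradient, is positive semidefinite\<close>
    have psdG: "pos_semidef ?G"
    proof -
      have "y \<bullet> (?G *v y) = (\<Sum>i\<in>UNIV. y $ i * ?g $ i)\<^sup>2" for y
        by (simp add: inner_vec_def matrix_vector_mult_def power2_eq_square sum_product
            sum_distrib_left mult_ac)
      then show ?thesis by (simp add: pos_semidef_def transpose_def vec_eq_iff mult.commute)
    qed
    have "0 \<le> ?n * (det ?G powr (1 / ?n) * det (hessian v x) powr ((?n - 1) / ?n))" by simp
    also have "\<dots> \<le> det_deriv (hessian v x) ?G" by (intro det_deriv_ge n psd psdG x)
    finally have G: "det_deriv (hessian v x) ?G \<ge> 0" .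
    have "(\<chi> i j. p2 i j x) = cutoff'' k ?w *\<^sub>R ?G + (- cutoff' k ?w) *\<^sub>R hessian v x"
      by (simp add: vec_eq_iff p2_def hessian_nth)
    then have "b x = u x * (cutoff'' k ?w * det_deriv (hessian v x) ?G - cutoff' k ?w * (?n * det (hessian v x)))"
      unfolding b_def by (simp only: det_deriv_add det_deriv_scale det_deriv_self) simp
    also have "\<dots> = - \<bar>u x\<bar> * (cutoff'' k ?w * det_deriv (hessian v x) ?G) + cutoff' k ?w * (?n * (\<bar>u x\<bar> * det (hessian v x)))"
      using nonpos[OF x] by (simp add: algebra_simps)
    also have "\<dots> \<le> 0 + 1 * (?n * (\<bar>u x\<bar> * det (hessian v x)))"
      using G cutoff_bounds[OF k] det_pos_semidef[OF psd(2)[OF x]]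
      by (intro add_mono mult_right_mono) (auto simp: mult_nonneg_nonneg)
    finally show ?thesis by simp
  qed

  have "(\<integral>\<^sup>+x\<in>\<Omega>. ennreal (p x * r x) \<partial>lborel) \<le> (\<integral>\<^sup>+x. ennreal (indicator \<Omega> x * a x / ?n) \<partial>lborel)"
    using a_ge by (intro nn_integral_mono) (auto simp: indicator_def field_simps intro!: ennreal_leI)
  also have "\<dots> = ennreal (\<integral>x. indicator \<Omega> x * a x / ?n \<partial>lborel)"
  proof (rule nn_integral_eq_integral)
    show "integrable lborel (\<lambda>x. indicator \<Omega> x * a x / ?n)" using int(1) by simp
    have "0 \<le> a x" if "x \<in> \<Omega>" for x
    proof -
      have "0 \<le> ?n * (p x * r x)" using cutoff_bounds[OF k] by (simp add: p_def r_def)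
      then show ?thesis using a_ge[OF that] by linarith
    qed
    then show "AE x in lborel. 0 \<le> indicator \<Omega> x * a x / ?n" by (auto simp: indicator_def)
  qed
  also have "\<dots> = ennreal (\<integral>x. indicator \<Omega> x * b x / ?n \<partial>lborel)" using int_eq by simp
  also have "\<dots> \<le> (\<integral>\<^sup>+x. ennreal (indicator \<Omega> x * b x / ?n) \<partial>lborel)"
    using int(2) by (intro ennreal_integral_le_nn_integral) simp
  also have "\<dots> \<le> (\<integral>\<^sup>+x\<in>\<Omega>. ennreal (\<bar>u x\<bar> * det (hessian v x)) \<partial>lborel)"
    using b_le by (intro nn_integral_mono) (auto simp: indicator_def field_simps intro!: ennreal_leI)
  finally show ?thesis unfolding p_def r_def .
qed

theorem proposition1p7:
  fixes \<Omega> :: "(real ^ 'n::finite) set"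
    and u v :: "real ^ 'n \<Rightarrow> real"
    and M :: real
  assumes "CARD('n) \<ge> 2"
    and "bounded \<Omega>" and "open \<Omega>" and "convex \<Omega>" and "interior \<Omega> \<noteq> {}"
    and "continuous_on (closure \<Omega>) u" and "C_on 5 \<Omega> u"
    and "continuous_on (closure \<Omega>) v" and "C_on 5 \<Omega> v"
    and "strictly_convex_on \<Omega> u" and "strictly_convex_on \<Omega> v"
    and "\<forall>x\<in>frontier \<Omega>. u x = 0" and "\<forall>x\<in>frontier \<Omega>. v x = 0"
    and "M > 0"
    and "(\<integral>\<^sup>+x\<in>\<Omega>. ennreal (det (hessian u x) powr (1 / real CARD('n))
            * det (hessian v x) powr ((real CARD('n) - 1) / real CARD('n))) \<partial>lborel) \<le> ennreal M"
    and "(\<integral>\<^sup>+x\<in>\<Omega>. ennreal (det (hessian v x)) \<partial>lborel) \<le> ennreal M"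
  shows "(\<integral>\<^sup>+x\<in>\<Omega>. ennreal (\<bar>u x\<bar> * det (hessian v x)) \<partial>lborel)
       \<ge> (\<integral>\<^sup>+x\<in>\<Omega>. ennreal (\<bar>v x\<bar> * det (hessian u x) powr (1 / real CARD('n))
            * det (hessian v x) powr ((real CARD('n) - 1) / real CARD('n))) \<partial>lborel)"
proof -
  let ?n = "real CARD('n)"
  define r where "r x = det (hessian u x) powr (1 / ?n) * det (hessian v x) powr ((?n - 1) / ?n)" for x
  define f where "f m x = ennreal (cutoff (real (Suc m)) (- v x) * r x) * indicator \<Omega> x" for m x
  let ?B = "\<integral>\<^sup>+x\<in>\<Omega>. ennreal (\<bar>u x\<bar> * det (hessian v x)) \<partial>lborel"
  have C: "C_on 2 \<Omega> u" "C_on 3 \<Omega> v" "C_on 2 \<Omega> v"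
    using assms(7,9) by (auto intro: C_on_le[of 5])
  have u_nonpos: "u x \<le> 0" and v_nonpos: "v x \<le> 0" if "x \<in> \<Omega>" for x
    using strictly_convex_nonpos[OF assms(2,3,6,10,12) that]
      strictly_convex_nonpos[OF assms(2,3,8,11,13) that] by auto
  have bound: "(\<integral>\<^sup>+x. f m x \<partial>lborel) \<le> ?B" for m
    unfolding f_def r_def
    using assms C u_nonpos
    by (intro cutoff_integral_inequality) (auto simp: strictly_convex_on_def)
  have meas: "f m \<in> borel_measurable lborel" for m
  proof -
    have \<Omega>: "\<Omega> \<in> sets borel" using assms(3) by (rule borel_open)
    have restr: "(\<lambda>x. indicator \<Omega> x *\<^sub>R g x) \<in> borel_measurable borel"
      if "continuous_on \<Omega> g" for g :: "real ^ 'n \<Rightarrow> real"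
      using \<Omega> that by (rule borel_measurable_continuous_on_indicator)
    have "continuous_on \<Omega> (\<lambda>x. cutoff (real (Suc m)) (- v x))"
      using C_on_imp_continuous_on[OF C(2)]
      by (intro continuous_on_compose2[OF continuous_on_cutoff(1)[of "real (Suc m)" UNIV]] continuous_intros) auto
    note [measurable] = restr[OF this]
      restr[OF continuous_on_det[OF continuous_on_hessian[OF C(1)]]]
      restr[OF continuous_on_det[OF continuous_on_hessian[OF C(3)]]]
    have "f m = (\<lambda>x. ennreal ((indicator \<Omega> x *\<^sub>R cutoff (real (Suc m)) (- v x)) *
        ((indicator \<Omega> x *\<^sub>R det (hessian u x)) powr (1 / ?n)
          * (indicator \<Omega> x *\<^sub>R det (hessian v x)) powr ((?n - 1) / ?n))))"
      by (auto simp: f_def r_def fun_eq_iff indicator_def)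
    also have "\<dots> \<in> borel_measurable lborel" by measurable
    finally show ?thesis .
  qed
  have lim: "liminf (\<lambda>m. f m x) = ennreal (\<bar>v x\<bar> * r x) * indicator \<Omega> x" for x
  proof (cases "x \<in> \<Omega>")
    case True
    have "(\<lambda>m. cutoff (real (Suc m)) (- v x) * r x) \<longlonglongrightarrow> \<bar>v x\<bar> * r x"
      using cutoff_tendsto[of "- v x"] v_nonpos[OF True] by (intro tendsto_mult tendsto_const) simp
    then have "(\<lambda>m. f m x) \<longlonglongrightarrow> ennreal (\<bar>v x\<bar> * r x) * indicator \<Omega> x"
      using True by (simp add: f_def)
    then show ?thesis by (intro lim_imp_Liminf) auto
  qed (simp add: f_def Liminf_const)
  have "(\<integral>\<^sup>+x\<in>\<Omega>. ennreal (\<bar>v x\<bar> * r x) \<partial>lborel) = (\<integral>\<^sup>+x. liminf (\<lambda>m. f m x) \<partial>lborel)"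
    by (simp add: lim)
  also have "\<dots> \<le> liminf (\<lambda>m. \<integral>\<^sup>+x. f m x \<partial>lborel)"
    by (rule nn_integral_liminf[OF meas])
  also have "\<dots> \<le> ?B"
    using bound Liminf_mono[of "\<lambda>m. \<integral>\<^sup>+x. f m x \<partial>lborel" "\<lambda>_. ?B" sequentially]
    by (simp add: Liminf_const)
  finally show ?thesis by (simp add: r_def mult.assoc)
qed

end
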